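(* For each integer $n\ge 2$ let $w_n$ denote the smallest cardinality of a finite origin-symmetric set $A\subset\mathbb{S}^{n-1}$ whose covering radius does not exceed $\arccos\sqrt{\tfrac{n-1}{2n}}$. Then $$w_5\le 30,\quad w_6\le 44,\quad w_7\le 112,\quad w_8\le 240,\quad w_9\le 470,\quad w_{10}\le 692,$$ $$w_{11}\le 2024,\quad w_{12}\le 3832,\quad w_{13}\le 7074,\quad w_{14}\le 11132,\quad w_{15}\le 16442.$$
   Context: $\mathbb{S}^{n-1}$ is the unit sphere of the $n$-dimensional Euclidean space $\mathbb{E}^n$. A set $A\subset\mathbb{S}^{n-1}$ is origin-symmetric if $-A=A$. For a finite set $A\subset\mathbb{S}^{n-1}$, the covering radius of $A$ is the smallest $r>0$ such that the union of the (closed) spherical balls of radius $r$ centered at the points of $A$ is all of $\mathbb{S}^{n-1}$, where distance on the sphere is angular (geodesic) distance: the spherical ball of radius $r$ centered at $y$ is $\{x\in\mathbb{S}^{n-1}:\langle x,y\rangle\ge\cos r\}$ for $0<r\le\pi$. *)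

theory Defs
  imports "HOL-Analysis.Analysis"
begin

definition spherical_ball :: "'a::euclidean_space \<Rightarrow> real \<Rightarrow> 'a set" where
  "spherical_ball y r = {x \<in> sphere 0 1. x \<bullet> y \<ge> cos r}"

text \<open>
  The minimum exists for every finite nonempty \<open>A \<subseteq> sphere 0 1\<close> in dimension at least 2.
  For \<open>A = {}\<close> no \<open>r\<close> qualifies and the value of \<open>LEAST\<close> is unspecified, so uses of
  \<open>covering_radius\<close> must assume \<open>A \<noteq> {}\<close>. The bound \<open>r \<le> pi\<close> is the range in which
  \<open>spherical_ball y r\<close> is the ball of angular radius \<open>r\<close>.
\<close>

definition covering_radius :: "'a::euclidean_space set \<Rightarrow> real" where
  "covering_radius A =
     (LEAST r. 0 < r \<and> r \<le> pi \<and> (\<Union>y\<in>A. spherical_ball y r) = sphere 0 1)"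

definition origin_symmetric :: "'a::euclidean_space set \<Rightarrow> bool" where
  "origin_symmetric A \<longleftrightarrow> uminus ` A = A"

text \<open>
  \<open>w TYPE('n)\<close> is the number \<open>w\<^sub>n\<close> for \<open>n = CARD('n) \<ge> 2\<close>; e.g. \<open>w TYPE(5)\<close> concerns the
  unit sphere of \<open>real ^ 5\<close>.
\<close>

definition w :: "'n::finite itself \<Rightarrow> nat" where
  "w _ = (LEAST k. \<exists>A :: (real ^ 'n) set.
      finite A \<and> A \<noteq> {} \<and> A \<subseteq> sphere 0 1 \<and> origin_symmetric A \<and>
      covering_radius A \<le> arccos (sqrt ((real CARD('n) - 1) / (2 * real CARD('n)))) \<and>
      card A = k)"

end

theory Submission
  imports Defs
begin

text \<open>
  Put \<open>c\<^sup>2 = (n - 1) / (2 * n)\<close>. A point of the sphere at angular distance more than \<open>arccos c\<close> from every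
  point of \<open>A\<close> can be lengthened a little without any of its inner products with \<open>A\<close> exceeding \<open>c\<close>.
  So \<open>A\<close> covers as soon as every \<open>x\<close> with \<open>x \<bullet> y \<le> c\<close> for all \<open>y \<in> A\<close> has norm at most one
  (\<open>w_le_of_polar\<close>), and each bound on \<open>w\<close> amounts to a small symmetric \<open>A\<close> with this property.

  The sets below are unions of two kinds of orbits. The first kind consists of all sign changes of a
  nonnegative vector, usually the vector with entries \<open>1 / sqrt k\<close> on a set \<open>S\<close> of \<open>k\<close> coordinates; with
  \<open>a i = \<bar>x $ i\<bar> / c\<close> such an orbit says \<open>(\<Sum>i\<in>S. a i) \<le> sqrt k\<close>. The second kind consists of vectors with
  all entries \<open>1 / sqrt n\<close> or \<open>- 1 / sqrt n\<close>, where the set of negative coordinates ranges over a code \<open>C\<close>;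
  if the signs of \<open>x\<close> are those of a codeword except on a set \<open>T\<close>, then
  \<open>(\<Sum>i<n. a i) - 2 * (\<Sum>i\<in>T. a i) \<le> sqrt n\<close>. From these linear constraints one has to derive
  \<open>(\<Sum>i<n. (a i)\<^sup>2) \<le> 1 / c\<^sup>2 = 2 * n / (n - 1)\<close> (\<open>w_le_of_patterns\<close>, \<open>w_le_of_sets\<close>).

  Apart from the dimensions 5 and 7, only the decreasing rearrangement \<open>z\<close> of \<open>a\<close> is used.
  All \<open>k\<close>-sets bound the sum of the \<open>k\<close> largest entries. The \<open>k\<close>-sets inside the two parts of a partition
  are much fewer, and they still bound \<open>z (k - 1) + \<dots> + z (2 * k - 2)\<close>, because \<open>k\<close> of the \<open>2 * k - 1\<close>
  largest entries lie in the same part. The code is that of an even number of negative signs among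
  \<open>m \<in> {n - 1, n}\<close> coordinates; at most one sign change turns a sign vector into a codeword, and it can be
  made at one of the smallest entries, so the loss is at most \<open>2 * z (m - 1)\<close>. The sizes are as follows.

  \<^item> \<open>n = 6\<close>: \<open>k = 1\<close> and \<open>m = 6\<close>, that is \<open>12 + 32 = 44\<close> vectors.
  \<^item> \<open>n = 8, 9, 10\<close>: \<open>k = 2\<close> and \<open>m = 8, 8, 10\<close>, that is \<open>112 + 128\<close>, \<open>144 + 256\<close> and \<open>180 + 512\<close> vectors.
  \<^item> \<open>n = 11\<close>: \<open>k = 2\<close>, 3-sets inside parts of 6 and 5 coordinates, and \<open>m = 10\<close>, that is
    \<open>220 + 240 + 1024\<close> vectors.
  \<^item> \<open>n = 12, 13, 14\<close>: \<open>k = 1\<close>, \<open>k = 3\<close> and \<open>m = 12, 12, 14\<close>, that is \<open>24 + 1760 + 2048\<close>,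
    \<open>26 + 2288 + 4096\<close> and \<open>28 + 2912 + 8192\<close> vectors.
  \<^item> \<open>n = 15\<close>: \<open>k = 1\<close>, \<open>k = 3\<close>, 4-sets inside parts of 8 and 7 coordinates, and the code of the sets whose
    cardinality is divisible by 3 or equal to 1 or 14, that is \<open>30 + 3640 + 1680 + 10952\<close> vectors.

  The constraints bound the sum of squares in the same way each time. The few largest entries are kept as
  variables; the remaining ones lie below the last of these, so that their squares are controlled by their
  sum, which the code constraint bounds (\<open>tail_bound\<close>, \<open>tail_bound_two\<close>). What is left is a quadratic
  inequality on a polytope of small dimension. Each is proved by adding products of the nonnegative linear
  forms that define the polytope.

  In dimension 5 the space is split as \<open>\<real>\<^sup>3 \<times> \<real>\<^sup>2\<close>, with \<open>6 + 8 + 8 = 22\<close> points for the first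
  factor and the \<open>4 + 4 = 8\<close> vertices of a regular octagon for the second, hence 30 in total. In dimension 7
  the supports are the points and lines of a Fano plane, the pairs inside one line, and the pairs in the complement of this line, which gives
  \<open>14 + 56 + 12 + 24 = 106\<close> vectors. There the bound is attained by the constant vector, and it needs an
  argument of its own (\<open>fano_quadratic\<close>).
\<close>

section \<open>The polar form of the covering condition\<close>

lemma infinite_sphere_vec:
  assumes "2 \<le> CARD('n::finite)"
  shows "infinite (sphere (0::real^'n) 1)"
proof
  assume fin: "finite (sphere (0::real^'n) 1)"
  obtain i :: 'n where True by simp
  have "connected (sphere (0::real^'n) 1)"
    using assms by (intro connected_sphere) simp
  then obtain v where "sphere (0::real^'n) 1 \<subseteq> {v}"
    using fin by (auto simp: connected_finite_iff_sing)
  moreover have "axis i 1 \<in> sphere (0::real^'n) 1" "- axis i 1 \<in> sphere (0::real^'n) 1"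
    by (simp_all add: norm_axis_1)
  ultimately have "axis i (1::real) = - axis i 1"
    by blast
  then show False
    by (auto simp: vec_eq_iff axis_def split: if_splits dest: spec[of _ i])
qed

text \<open>
  The least radius in the definition of the covering radius is attained: the balls of radius \<open>r\<close> cover exactly
  when \<open>cos r\<close> is at most the minimum over the sphere of the continuous function \<open>x \<mapsto> max {x \<bullet> y | y \<in> A}\<close>, and
  this minimum is below 1 because the sphere is infinite while \<open>A\<close> is finite.
\<close>

lemma covering_radius_le:
  fixes A :: "(real^'n::finite) set"
  assumes n: "2 \<le> CARD('n)" and fin: "finite A" and ne: "A \<noteq> {}" and sub: "A \<subseteq> sphere 0 1"
    and c: "-1 \<le> c" "c < 1"
    and cov: "\<And>x. x \<in> sphere 0 1 \<Longrightarrow> \<exists>y\<in>A. c \<le> x \<bullet> y"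
  shows "covering_radius A \<le> arccos c"
proof -
  define f where "f x = Max ((\<lambda>y. x \<bullet> y) ` A)" for x :: "real^'n"
  have f_ge: "t \<le> f x \<longleftrightarrow> (\<exists>y\<in>A. t \<le> x \<bullet> y)" for t x
    unfolding f_def using fin ne by (subst Max_ge_iff) auto
  have "continuous_on (sphere 0 1) f"
    unfolding f_def using fin ne
  proof (induction A rule: finite_ne_induct)
    case (insert y F)
    then have "continuous_on (sphere 0 1) (\<lambda>x. max (x \<bullet> y) (Max ((\<lambda>y. x \<bullet> y) ` F)))"
      by (intro continuous_intros)
    then show ?case using insert.hyps by simp
  qed (auto intro!: continuous_intros)
  moreover have "sphere (0::real^'n) 1 \<noteq> {}" using ne sub by blast
  ultimately obtain x0 where x0: "x0 \<in> sphere 0 1" "\<And>x. x \<in> sphere 0 1 \<Longrightarrow> f x0 \<le> f x"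
    using continuous_attains_inf[OF compact_sphere] by metis
  have c_le: "c \<le> f x0" using cov[OF x0(1)] f_ge by blast
  have ip1: "x \<bullet> y \<le> 1" if "x \<in> sphere 0 1" "y \<in> sphere 0 1" for x y :: "real^'n"
    using norm_cauchy_schwarz[of x y] that by simp
  have f1: "f x0 < 1"
  proof (rule ccontr)
    assume "\<not> f x0 < 1"
    have "x \<in> A" if x: "x \<in> sphere 0 1" for x
    proof -
      have "1 \<le> f x" using x0(2)[OF x] \<open>\<not> f x0 < 1\<close> by linarith
      then obtain y where y: "y \<in> A" "1 \<le> x \<bullet> y" using f_ge by blast
      have "(norm (x - y))\<^sup>2 = (norm x)\<^sup>2 + (norm y)\<^sup>2 - 2 * (x \<bullet> y)"
        by (simp add: power2_norm_eq_inner inner_diff inner_commute)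
      also have "\<dots> \<le> 0" using x y sub by auto
      finally show "x \<in> A" using y by simp
    qed
    then have "sphere (0::real^'n) 1 \<subseteq> A" by (rule subsetI)
    then show False using infinite_sphere_vec[OF n] finite_subset[OF _ fin] by metis
  qed
  have covers_iff: "(\<Union>y\<in>A. spherical_ball y r) = sphere 0 1 \<longleftrightarrow> cos r \<le> f x0" for r
  proof -
    have "(\<Union>y\<in>A. spherical_ball y r) = sphere 0 1 \<longleftrightarrow> (\<forall>x\<in>sphere 0 1. cos r \<le> f x)"
      unfolding f_ge spherical_ball_def by auto
    also have "\<dots> \<longleftrightarrow> cos r \<le> f x0"
      using x0(1) x0(2) by (meson order.trans)
    finally show ?thesis .
  qed
  have bds: "-1 \<le> f x0" "f x0 \<le> 1" using c c_le f1 by linarith+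
  have "covering_radius A = arccos (f x0)"
    unfolding covering_radius_def covers_iff
  proof (rule Least_equality)
    show "0 < arccos (f x0) \<and> arccos (f x0) \<le> pi \<and> cos (arccos (f x0)) \<le> f x0"
      using bds f1 arccos_less_mono[of 1 "f x0"] by (auto intro: arccos_ubound)
    show "arccos (f x0) \<le> r" if r: "0 < r \<and> r \<le> pi \<and> cos r \<le> f x0" for r
    proof -
      have "arccos (f x0) \<le> arccos (cos r)"
        using r bds by (intro arccos_le_arccos) auto
      then show ?thesis using r by (simp add: arccos_cos)
    qed
  qed
  also have "\<dots> \<le> arccos c"
    using c c_le bds by (intro arccos_le_arccos) auto
  finally show ?thesis .
qed

text \<open>
  If some \<open>x\<close> on the sphere had \<open>x \<bullet> y < c\<close> for all \<open>y \<in> A\<close>, then rescaling \<open>x\<close> until the largest of these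
  products equals \<open>c\<close> would give a vector longer than 1 that still meets the constraints.
\<close>

lemma w_le_of_polar:
  fixes A :: "(real^'n::finite) set"
  assumes n: "2 \<le> CARD('n)" and fin: "finite A" and sub: "A \<subseteq> sphere 0 1"
    and sym: "\<And>y. y \<in> A \<Longrightarrow> - y \<in> A"
    and c: "c = sqrt ((real CARD('n) - 1) / (2 * real CARD('n)))"
    and polar: "\<And>x. (\<And>y. y \<in> A \<Longrightarrow> x \<bullet> y \<le> c) \<Longrightarrow> norm x \<le> 1"
    and card: "card A \<le> N"
  shows "w TYPE('n) \<le> N"
proof -
  have c01: "0 < c" "c < 1" using n unfolding c by (simp_all add: field_simps)
  have cov: "\<exists>y\<in>A. c \<le> x \<bullet> y" if x: "x \<in> sphere 0 1" for x
  proof (rule ccontr)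
    assume neg: "\<not> (\<exists>y\<in>A. c \<le> x \<bullet> y)"
    \<comment> \<open>Including \<open>c / 2\<close> keeps the scaling factor \<open>c / M\<close> meaningful if all inner products are nonpositive.\<close>
    define M where "M = Max (insert (c/2) ((\<lambda>y. x \<bullet> y) ` A))"
    have fin': "finite (insert (c/2) ((\<lambda>y. x \<bullet> y) ` A))" using fin by simp
    have M: "M < c" "c/2 \<le> M" "\<And>y. y \<in> A \<Longrightarrow> x \<bullet> y \<le> M"
      using neg c01 Max_ge[OF fin', of "c/2"] Max_ge[OF fin'] Max_less_iff[OF fin']
      unfolding M_def by (auto simp: not_le)
    have "norm ((c / M) *\<^sub>R x) \<le> 1"
    proof (rule polar)
      fix y assume "y \<in> A"
      then have "(c / M) * (x \<bullet> y) \<le> (c / M) * M"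
        using M c01 by (intro mult_left_mono) auto
      then show "((c / M) *\<^sub>R x) \<bullet> y \<le> c" using M c01 by simp
    qed
    moreover have "1 < c / M" using M c01 by (simp add: less_divide_eq)
    moreover have "norm ((c / M) *\<^sub>R x) = c / M" using M c01 x by simp
    ultimately show False by linarith
  qed
  have ne: "A \<noteq> {}"
  proof
    assume "A = {}"
    obtain i :: 'n where True by simp
    have "axis i 1 \<in> sphere (0::real^'n) 1" by (simp add: norm_axis_1)
    then show False using cov \<open>A = {}\<close> by blast
  qed
  have "uminus ` A = A"
  proof (intro equalityI subsetI)
    show "y \<in> A" if "y \<in> uminus ` A" for y using that sym by auto
    show "y \<in> uminus ` A" if "y \<in> A" for y using sym[OF that] by (intro image_eqI[of _ _ "- y"]) auto
  qed
  moreover have "covering_radius A \<le> arccos c"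
    using covering_radius_le[OF n fin ne sub _ _ cov] c01 by simp
  ultimately have "w TYPE('n) \<le> card A"
    unfolding w_def c using fin ne sub
    by (intro Least_le exI[of _ A]) (auto simp: origin_symmetric_def)
  then show ?thesis using card by simp
qed

section \<open>Orbits under sign changes\<close>

text \<open>
  A vector with prescribed absolute values is determined by the set of its negative coordinates. The injection
  \<open>p\<close> numbers the coordinates, so that codes can be given as families of sets of natural numbers.
\<close>

lemma signed_vectors_card:
  fixes v :: "'n::finite \<Rightarrow> real" and p :: "'n \<Rightarrow> nat"
  assumes "inj p" "finite D"
  defines "B \<equiv> {y :: real^'n. (\<forall>i. \<bar>y $ i\<bar> = v i) \<and> p ` {i. y $ i < 0} \<in> D}"
  shows "finite B" "card B \<le> card D"
proof -
  have inj: "inj_on (\<lambda>y. p ` {i. y $ i < 0}) B"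
  proof (rule inj_onI)
    fix y z :: "real^'n" assume yz: "y \<in> B" "z \<in> B" "p ` {i. y $ i < 0} = p ` {i. z $ i < 0}"
    then have "{i. y $ i < 0} = {i. z $ i < 0}" using assms(1) by (simp add: inj_image_eq_iff)
    moreover have "\<bar>y $ i\<bar> = \<bar>z $ i\<bar>" for i using yz by (simp add: B_def)
    ultimately have "y $ i = z $ i" for i
      by (metis abs_of_neg abs_of_nonneg mem_Collect_eq neg_equal_iff_equal not_le)
    then show "y = z" by (simp add: vec_eq_iff)
  qed
  have sub: "(\<lambda>y. p ` {i. y $ i < 0}) ` B \<subseteq> D" by (auto simp: B_def)
  show "finite B" using inj sub assms(2) by (meson finite_imageD finite_subset)
  show "card B \<le> card D" using card_inj_on_le[OF inj sub assms(2)] .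
qed

text \<open>
  The constraint that an orbit imposes on \<open>x\<close> is strongest for the representative whose signs agree with those
  of \<open>x\<close>. For a full orbit of \<open>u \<in> U\<close> this is a constraint on \<open>a i = \<bar>x $ i\<bar> / c\<close> alone. For the sign vectors of
  \<open>C\<close>, let \<open>Z\<close> be the set of negative coordinates of \<open>x\<close>; a codeword differs from \<open>Z\<close> in a set \<open>T\<close>, whose
  coordinates enter the inner product negatively.
\<close>

theorem w_le_of_patterns:
  fixes U :: "(nat \<Rightarrow> real) set" and C :: "nat set set"
  assumes n: "CARD('n::finite) = n" "2 \<le> n"
    and U: "finite U" "\<And>u i. u \<in> U \<Longrightarrow> i < n \<Longrightarrow> 0 \<le> u i" "\<And>u. u \<in> U \<Longrightarrow> (\<Sum>i<n. (u i)\<^sup>2) = 1"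
    and C: "\<And>Z. Z \<in> C \<Longrightarrow> Z \<subseteq> {..<n}" "\<And>Z. Z \<in> C \<Longrightarrow> {..<n} - Z \<in> C"
    and card: "(\<Sum>u\<in>U. 2 ^ card {i. i < n \<and> u i \<noteq> 0}) + card C \<le> N"
    and bound: "\<And>(a :: nat \<Rightarrow> real) Z. (\<And>i. 0 \<le> a i) \<Longrightarrow> (\<And>u. u \<in> U \<Longrightarrow> (\<Sum>i<n. u i * a i) \<le> 1) \<Longrightarrow>
      Z \<subseteq> {..<n} \<Longrightarrow>
      (\<And>T. T \<subseteq> {..<n} \<Longrightarrow> sym_diff Z T \<in> C \<Longrightarrow> (\<Sum>i<n. a i) - 2 * (\<Sum>i\<in>T. a i) \<le> sqrt n) \<Longrightarrow>
      (\<Sum>i<n. (a i)\<^sup>2) \<le> 2 * real n / (real n - 1)"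
  shows "w TYPE('n) \<le> N"
proof -
  obtain p :: "'n \<Rightarrow> nat" where p: "bij_betw p UNIV {..<n}"
    using ex_bij_betw_finite_nat[of "UNIV :: 'n set"] n by (auto simp: atLeast0LessThan)
  have inj: "inj p" and p_lt: "p i < n" for i
    using p by (auto simp: bij_betw_def)
  have sum_p: "(\<Sum>i\<in>UNIV. f (p i)) = (\<Sum>j<n. f j)" for f :: "nat \<Rightarrow> real"
    using sum.reindex_bij_betw[OF p] .
  define c where "c = sqrt ((real CARD('n) - 1) / (2 * real CARD('n)))"
  have c: "0 < c" "c\<^sup>2 = (real n - 1) / (2 * real n)"
    using n unfolding c_def by simp_all
  define O1 where "O1 u = {y :: real^'n. (\<forall>i. \<bar>y $ i\<bar> = u (p i)) \<and> p ` {i. y $ i < 0} \<in> Pow {i. i < n \<and> u i \<noteq> 0}}"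
    for u
  define O2 where "O2 = {y :: real^'n. (\<forall>i. \<bar>y $ i\<bar> = 1 / sqrt n) \<and> p ` {i. y $ i < 0} \<in> C}"
  have finC: "finite C" using C(1) by (meson Pow_iff finite_Pow_iff finite_lessThan finite_subset subsetI)
  have O1: "finite (O1 u)" "card (O1 u) \<le> 2 ^ card {i. i < n \<and> u i \<noteq> 0}" for u
    using signed_vectors_card[OF inj, of "Pow {i. i < n \<and> u i \<noteq> 0}"] unfolding O1_def
    by (auto simp: card_Pow)
  have O2: "finite O2" "card O2 \<le> card C"
    using signed_vectors_card[OF inj finC] unfolding O2_def by auto
  show ?thesis
  proof (rule w_le_of_polar[of "(\<Union>u\<in>U. O1 u) \<union> O2" c])
    show "2 \<le> CARD('n)" using n by simp
    show "finite ((\<Union>u\<in>U. O1 u) \<union> O2)" using U O1 O2 by simp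
    show "(\<Union>u\<in>U. O1 u) \<union> O2 \<subseteq> sphere 0 1"
    proof
      fix y assume "y \<in> (\<Union>u\<in>U. O1 u) \<union> O2"
      then obtain v where v: "\<And>i. \<bar>y $ i\<bar> = v (p i)" "(\<Sum>i<n. (v i)\<^sup>2) = 1"
      proof
        assume "y \<in> (\<Union>u\<in>U. O1 u)"
        then show thesis using that U(3) unfolding O1_def by blast
      next
        assume "y \<in> O2"
        then show thesis using n by (intro that[of "\<lambda>i. 1 / sqrt n"]) (auto simp: O2_def power_divide)
      qed
      have "(\<Sum>i\<in>UNIV. (y $ i)\<^sup>2) = (\<Sum>i\<in>UNIV. (v (p i))\<^sup>2)"
        using v(1) by (metis power2_abs)
      then show "y \<in> sphere 0 1" using sum_p[of "\<lambda>i. (v i)\<^sup>2"] v(2) by (simp add: norm_vec_def L2_set_def)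
    qed
    show "- y \<in> (\<Union>u\<in>U. O1 u) \<union> O2" if y: "y \<in> (\<Union>u\<in>U. O1 u) \<union> O2" for y
    proof -
      have "- y \<in> O1 u" if "y \<in> O1 u" for u
      proof -
        have abs_y: "\<bar>y $ i\<bar> = u (p i)" for i using that by (simp add: O1_def)
        have "u (p i) \<noteq> 0" if "0 < y $ i" for i using abs_y[of i] that by linarith
        then show ?thesis using abs_y p_lt by (auto simp: O1_def)
      qed
      moreover have "- y \<in> O2" if "y \<in> O2"
      proof -
        have "y $ i \<noteq> 0" for i using that n unfolding O2_def by (auto dest!: spec[of _ i])
        then have "{i. (- y) $ i < 0} = UNIV - {i. y $ i < 0}"
          by (auto simp: not_less_iff_gr_or_eq)
        then have "p ` {i. (- y) $ i < 0} = {..<n} - p ` {i. y $ i < 0}"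
          using p inj by (simp add: image_set_diff bij_betw_def)
        then show ?thesis using that C(2) unfolding O2_def by simp
      qed
      ultimately show ?thesis using y by blast
    qed
    show "c = sqrt ((real CARD('n) - 1) / (2 * real CARD('n)))" by (rule c_def)
    have "card ((\<Union>u\<in>U. O1 u) \<union> O2) \<le> (\<Sum>u\<in>U. card (O1 u)) + card O2"
      using card_Un_le[of "\<Union>u\<in>U. O1 u" O2] card_UN_le[OF U(1), of O1] by linarith
    also have "\<dots> \<le> (\<Sum>u\<in>U. 2 ^ card {i. i < n \<and> u i \<noteq> 0}) + card C"
      using O1 O2 by (intro add_mono sum_mono) auto
    finally show "card ((\<Union>u\<in>U. O1 u) \<union> O2) \<le> N" using card by simp
    fix x assume x: "\<And>y. y \<in> (\<Union>u\<in>U. O1 u) \<union> O2 \<Longrightarrow> x \<bullet> y \<le> c"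
    define a where "a j = \<bar>x $ inv p j\<bar> / c" for j
    have a_p: "\<bar>x $ i\<bar> = c * a (p i)" for i using c inj by (simp add: a_def)
    define Z where "Z = p ` {i. x $ i < 0}"
    have Z: "p i \<in> Z \<longleftrightarrow> x $ i < 0" for i using inj by (auto simp: Z_def inj_def)
    have "(\<Sum>i<n. (a i)\<^sup>2) \<le> 2 * real n / (real n - 1)"
    proof (rule bound[of a Z])
      show "0 \<le> a i" for i using c by (simp add: a_def)
      show "Z \<subseteq> {..<n}" using p_lt by (auto simp: Z_def)
    next
      fix u assume u: "u \<in> U"
      \<comment> \<open>The member of the orbit of \<open>u\<close> whose signs agree with those of \<open>x\<close>.\<close>
      define y :: "real^'n" where "y = (\<chi> i. (if x $ i < 0 then -1 else 1) * u (p i))"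
      have u0: "0 \<le> u (p i)" for i using U(2)[OF u p_lt] .
      have "y \<in> O1 u"
        unfolding O1_def y_def using u0 p_lt by (auto simp: abs_mult split: if_splits)
      then have "x \<bullet> y \<le> c" using x u by blast
      moreover have "x \<bullet> y = (\<Sum>i\<in>UNIV. c * (u (p i) * a (p i)))"
        unfolding inner_vec_def y_def
      proof (intro sum.cong refl)
        fix i show "(x $ i) \<bullet> ((\<chi> i. (if x $ i < 0 then -1 else 1) * u (p i)) $ i) = c * (u (p i) * a (p i))"
        proof (cases "x $ i < 0")
          case True
          then have "x $ i = - (c * a (p i))" using a_p[of i] by simp
          moreover have "(\<chi> i. (if x $ i < 0 then -1 else 1) * u (p i)) $ i = - u (p i)" using True by simp
          ultimately show ?thesis by simp
        qed (use a_p[of i] in simp)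
      qed
      ultimately have "c * (\<Sum>i<n. u i * a i) \<le> c * 1"
        using sum_p[of "\<lambda>i. c * (u i * a i)"] by (simp add: sum_distrib_left)
      then show "(\<Sum>i<n. u i * a i) \<le> 1" using c by simp
    next
      fix T assume T: "T \<subseteq> {..<n}" "sym_diff Z T \<in> C"
      define y :: "real^'n" where "y = (\<chi> i. (if p i \<in> sym_diff Z T then -1 else 1) / sqrt n)"
      have "{i. y $ i < 0} = {i. p i \<in> sym_diff Z T}"
        using n by (auto simp: y_def)
      then have "p ` {i. y $ i < 0} = sym_diff Z T"
        using C(1)[OF T(2)] p by (auto simp: bij_betw_def image_iff)
      then have "y \<in> O2"
        unfolding O2_def using T by (simp add: y_def)
      then have "x \<bullet> y \<le> c" using x by blast
      moreover have "x \<bullet> y = (\<Sum>i\<in>UNIV. c / sqrt n * (a (p i) - 2 * (if p i \<in> T then a (p i) else 0)))"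
        unfolding inner_vec_def
      proof (intro sum.cong refl)
        fix i show "(x $ i) \<bullet> (y $ i) = c / sqrt n * (a (p i) - 2 * (if p i \<in> T then a (p i) else 0))"
          using a_p[of i] Z[of i] by (cases "x $ i < 0") (auto simp: y_def field_simps)
      qed
      moreover have "(\<Sum>i<n. if i \<in> T then a i else 0) = (\<Sum>i\<in>T. a i)"
        using T(1) by (simp add: sum.If_cases Int_absorb1)
      ultimately have "c / sqrt n * ((\<Sum>i<n. a i) - 2 * (\<Sum>i\<in>T. a i)) \<le> c"
        unfolding sum_p[of "\<lambda>i. c / sqrt n * (a i - 2 * (if i \<in> T then a i else 0))"]
        by (simp only: sum_distrib_left[symmetric] sum_subtractf)
      then show "(\<Sum>i<n. a i) - 2 * (\<Sum>i\<in>T. a i) \<le> sqrt n"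
      proof -
        assume "c / sqrt n * ((\<Sum>i<n. a i) - 2 * (\<Sum>i\<in>T. a i)) \<le> c"
        then have "c * ((\<Sum>i<n. a i) - 2 * (\<Sum>i\<in>T. a i)) \<le> c * sqrt n"
          using n by (simp add: divide_le_eq)
        then show ?thesis using c by simp
      qed
    qed
    moreover have "(norm x)\<^sup>2 = c\<^sup>2 * (\<Sum>i<n. (a i)\<^sup>2)"
    proof -
      have "(norm x)\<^sup>2 = (\<Sum>i\<in>UNIV. \<bar>x $ i\<bar>\<^sup>2)"
        by (simp add: norm_vec_def L2_set_def sum_nonneg)
      also have "\<dots> = c\<^sup>2 * (\<Sum>i<n. (a i)\<^sup>2)"
        unfolding a_p power_mult_distrib sum_distrib_left[symmetric] using sum_p[of "\<lambda>i. (a i)\<^sup>2"] by simp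
      finally show ?thesis .
    qed
    ultimately have "(norm x)\<^sup>2 \<le> c\<^sup>2 * (2 * real n / (real n - 1))"
      using mult_left_mono[of "\<Sum>i<n. (a i)\<^sup>2" "2 * real n / (real n - 1)" "c\<^sup>2"] by simp
    also have "\<dots> = 1" using n unfolding c by (simp add: field_simps)
    finally show "norm x \<le> 1" by (simp add: abs_square_le_1)
  qed
qed

definition flat :: "nat set \<Rightarrow> nat \<Rightarrow> real" where
  "flat S i = (if i \<in> S then 1 / sqrt (card S) else 0)"

lemma sum_flat:
  assumes "S \<subseteq> {..<n}" "S \<noteq> {}"
  shows "(\<Sum>i<n. flat S i * a i) = (\<Sum>i\<in>S. a i) / sqrt (card S)"
    and "(\<Sum>i<n. (flat S i)\<^sup>2) = 1"
    and "card {i. i < n \<and> flat S i \<noteq> 0} = card S"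
proof -
  have fin: "finite S" using assms(1) finite_subset by blast
  have pos: "0 < card S" using fin assms(2) by (simp add: card_gt_0_iff)
  have "(\<Sum>i<n. flat S i * a i) = (\<Sum>i<n. if i \<in> S then a i / sqrt (card S) else 0)"
    by (intro sum.cong) (auto simp: flat_def)
  then show "(\<Sum>i<n. flat S i * a i) = (\<Sum>i\<in>S. a i) / sqrt (card S)"
    using assms(1) by (simp add: sum.If_cases Int_absorb1 sum_divide_distrib)
  have "(\<Sum>i<n. (flat S i)\<^sup>2) = (\<Sum>i<n. if i \<in> S then 1 / card S else 0)"
    by (intro sum.cong) (auto simp: flat_def power_divide)
  then show "(\<Sum>i<n. (flat S i)\<^sup>2) = 1"
    using assms(1) pos by (simp add: sum.If_cases Int_absorb1)
  have "{i. i < n \<and> flat S i \<noteq> 0} = S"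
    using assms(1) pos by (auto simp: flat_def)
  then show "card {i. i < n \<and> flat S i \<noteq> 0} = card S" by simp
qed

text \<open>
  In all dimensions but 5, the full orbits are those of vectors that are constant on their support.
\<close>

theorem w_le_of_sets:
  fixes F C :: "nat set set"
  assumes n: "CARD('n::finite) = n" "2 \<le> n"
    and F: "\<And>S. S \<in> F \<Longrightarrow> S \<subseteq> {..<n} \<and> S \<noteq> {}"
    and C: "\<And>Z. Z \<in> C \<Longrightarrow> Z \<subseteq> {..<n}" "\<And>Z. Z \<in> C \<Longrightarrow> {..<n} - Z \<in> C"
    and card: "(\<Sum>S\<in>F. 2 ^ card S) + card C \<le> N"
    and bound: "\<And>(a :: nat \<Rightarrow> real) Z. (\<And>i. 0 \<le> a i) \<Longrightarrow> (\<And>S. S \<in> F \<Longrightarrow> (\<Sum>i\<in>S. a i) \<le> sqrt (card S)) \<Longrightarrow>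
      Z \<subseteq> {..<n} \<Longrightarrow>
      (\<And>T. T \<subseteq> {..<n} \<Longrightarrow> sym_diff Z T \<in> C \<Longrightarrow> (\<Sum>i<n. a i) - 2 * (\<Sum>i\<in>T. a i) \<le> sqrt n) \<Longrightarrow>
      (\<Sum>i<n. (a i)\<^sup>2) \<le> 2 * real n / (real n - 1)"
  shows "w TYPE('n) \<le> N"
proof (rule w_le_of_patterns[OF n, of "flat ` F" C])
  have finF: "finite F" using F by (meson Pow_iff finite_Pow_iff finite_lessThan finite_subset subsetI)
  then show "finite (flat ` F)" by simp
  show "0 \<le> u i" if "u \<in> flat ` F" for u i using that by (auto simp: flat_def)
  show "(\<Sum>i<n. (u i)\<^sup>2) = 1" if "u \<in> flat ` F" for u using that F sum_flat(2) by blast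
  show "Z \<subseteq> {..<n}" "{..<n} - Z \<in> C" if "Z \<in> C" for Z using that C by auto
  have "(\<Sum>u\<in>flat ` F. 2 ^ card {i. i < n \<and> u i \<noteq> 0}) \<le> (\<Sum>S\<in>F. (2::nat) ^ card {i. i < n \<and> flat S i \<noteq> 0})"
    using sum_image_le[OF finF, of "\<lambda>u. (2::nat) ^ card {i. i < n \<and> u i \<noteq> 0}" flat] by (simp add: o_def)
  also have "\<dots> = (\<Sum>S\<in>F. 2 ^ card S)"
    using F sum_flat(3) by (intro sum.cong) auto
  finally show "(\<Sum>u\<in>flat ` F. 2 ^ card {i. i < n \<and> u i \<noteq> 0}) + card C \<le> N"
    using card by linarith
  fix a :: "nat \<Rightarrow> real" and Z
  assume a: "\<And>i. 0 \<le> a i" "\<And>u. u \<in> flat ` F \<Longrightarrow> (\<Sum>i<n. u i * a i) \<le> 1" "Z \<subseteq> {..<n}"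
    "\<And>T. T \<subseteq> {..<n} \<Longrightarrow> sym_diff Z T \<in> C \<Longrightarrow> (\<Sum>i<n. a i) - 2 * (\<Sum>i\<in>T. a i) \<le> sqrt n"
  show "(\<Sum>i<n. (a i)\<^sup>2) \<le> 2 * real n / (real n - 1)"
  proof (rule bound[OF a(1) _ a(3) a(4)])
    fix S assume S: "S \<in> F"
    then have "0 < card S" using F finite_subset by (metis card_gt_0_iff finite_lessThan)
    moreover have "(\<Sum>i\<in>S. a i) / sqrt (card S) \<le> 1" using a(2)[of "flat S"] S F sum_flat(1)[of S n a] by auto
    ultimately show "(\<Sum>i\<in>S. a i) \<le> sqrt (card S)" by (simp add: field_simps)
  qed
qed

text \<open>
  Explicit lists of patterns are counted entry by entry; bounding the sum over the set by the sum over the list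
  avoids any check that the entries are distinct.
\<close>

lemma sum_set_le_sum_list: "(\<Sum>x\<in>set xs. f x) \<le> (\<Sum>x\<leftarrow>xs. f x)" for f :: "'a \<Rightarrow> nat"
  by (induction xs) (auto simp: sum.insert_if)

section \<open>Families of supports and the parity code\<close>

definition k_sets :: "nat \<Rightarrow> nat \<Rightarrow> nat set set" where
  "k_sets n k = {S. S \<subseteq> {..<n} \<and> card S = k}"

definition split_sets :: "nat \<Rightarrow> nat \<Rightarrow> nat \<Rightarrow> nat set set" where
  "split_sets n h k = {S. (S \<subseteq> {..<h} \<or> S \<subseteq> {h..<n}) \<and> card S = k}"

text \<open>
  Codewords are identified with their sets of negative coordinates; the parity check involves only the first
  \<open>m\<close> coordinates.
\<close>

definition even_on :: "nat \<Rightarrow> nat \<Rightarrow> nat set set" where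
  "even_on n m = {Z. Z \<subseteq> {..<n} \<and> even (card (Z \<inter> {..<m}))}"

lemma finite_k_sets: "finite (k_sets n k)"
  by (rule finite_subset[of _ "Pow {..<n}"]) (auto simp: k_sets_def)

lemma card_k_sets: "card (k_sets n k) = n choose k"
  using n_subsets[of "{..<n}" k] by (simp add: k_sets_def)

lemma weight_k_sets: "(\<Sum>S\<in>k_sets n k. 2 ^ card S) = 2 ^ k * (n choose k)"
proof -
  have "(\<Sum>S\<in>k_sets n k. 2 ^ card S) = (\<Sum>S\<in>k_sets n k. 2 ^ k :: nat)"
    by (intro sum.cong) (auto simp: k_sets_def)
  then show ?thesis by (simp add: card_k_sets mult.commute)
qed

lemma finite_split_sets: "h \<le> n \<Longrightarrow> finite (split_sets n h k)"
  by (rule finite_subset[of _ "Pow {..<n}"]) (auto simp: split_sets_def)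

lemma weight_split_sets:
  assumes "h \<le> n"
  shows "(\<Sum>S\<in>split_sets n h k. 2 ^ card S) \<le> 2 ^ k * ((h choose k) + ((n - h) choose k))"
proof -
  have "split_sets n h k = {S. S \<subseteq> {..<h} \<and> card S = k} \<union> {S. S \<subseteq> {h..<n} \<and> card S = k}"
    by (auto simp: split_sets_def)
  then have "card (split_sets n h k) \<le> (h choose k) + ((n - h) choose k)"
    using card_Un_le[of "{S. S \<subseteq> {..<h} \<and> card S = k}" "{S. S \<subseteq> {h..<n} \<and> card S = k}"]
      n_subsets[of "{..<h}" k] n_subsets[of "{h..<n}" k] by simp
  moreover have "(\<Sum>S\<in>split_sets n h k. 2 ^ card S) = (\<Sum>S\<in>split_sets n h k. 2 ^ k :: nat)"
    by (intro sum.cong) (auto simp: split_sets_def)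
  ultimately show ?thesis by (simp add: mult.commute)
qed

lemma even_on_flip:
  assumes "Z \<subseteq> {..<n}" "t < m" "m \<le> n"
  shows "sym_diff Z {t} \<in> even_on n m \<longleftrightarrow> Z \<notin> even_on n m"
proof -
  define A B where "A = Z \<inter> {..<m}" and "B = sym_diff Z {t} \<inter> {..<m}"
  have fin: "finite A" "finite B" by (simp_all add: A_def B_def)
  have "card A = Suc (card B) \<or> card B = Suc (card A)"
  proof (cases "t \<in> Z")
    case True
    then have "A = insert t B" "t \<notin> B" using assms(2) by (auto simp: A_def B_def)
    then show ?thesis using fin by simp
  next
    case False
    then have "B = insert t A" "t \<notin> A" using assms(2) by (auto simp: A_def B_def)
    then show ?thesis using fin by simp
  qed
  then have "even (card B) \<longleftrightarrow> odd (card A)" by auto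
  moreover have "sym_diff Z {t} \<subseteq> {..<n}" using assms by auto
  ultimately show ?thesis using assms(1) unfolding even_on_def A_def B_def by blast
qed

text \<open>
  Toggling coordinate 0 exchanges the code with its complement.
\<close>

lemma card_even_on:
  assumes "0 < m" "m \<le> n"
  shows "card (even_on n m) = 2 ^ (n - 1)"
proof -
  let ?f = "\<lambda>Z. sym_diff Z {0}"
  have sub: "even_on n m \<subseteq> Pow {..<n}" by (auto simp: even_on_def)
  have f_sub: "?f Z \<subseteq> {..<n}" if "Z \<subseteq> {..<n}" for Z using that assms by auto
  have ff: "?f (?f Z) = Z" for Z :: "nat set" by auto
  have "bij_betw ?f (even_on n m) (Pow {..<n} - even_on n m)"
  proof (rule bij_betwI[of _ _ _ ?f])
    show "?f \<in> even_on n m \<rightarrow> Pow {..<n} - even_on n m"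
    proof
      fix Z assume Z: "Z \<in> even_on n m"
      then have Zn: "Z \<subseteq> {..<n}" using sub by blast
      show "?f Z \<in> Pow {..<n} - even_on n m"
        using even_on_flip[OF Zn assms] Z f_sub[OF Zn] by blast
    qed
    show "?f \<in> (Pow {..<n} - even_on n m) \<rightarrow> even_on n m"
    proof
      fix Z assume Z: "Z \<in> Pow {..<n} - even_on n m"
      then have Zn: "Z \<subseteq> {..<n}" by blast
      show "?f Z \<in> even_on n m"
        using even_on_flip[OF Zn assms] Z by blast
    qed
  qed (rule ff)+
  then have "card (even_on n m) = card (Pow {..<n} - even_on n m)" by (rule bij_betw_same_card)
  also have "\<dots> = card (Pow {..<n}) - card (even_on n m)"
    by (rule card_Diff_subset[OF finite_subset[OF sub] sub]) simp
  finally have "2 * card (even_on n m) = card (Pow {..<n})"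
    using card_mono[OF _ sub] by simp
  moreover have "card (Pow {..<n}) = 2 * 2 ^ (n - 1)" using assms by (cases n) (auto simp: card_Pow)
  ultimately show ?thesis by simp
qed

lemma even_on_compl:
  assumes "even m" "m \<le> n" "Z \<in> even_on n m"
  shows "{..<n} - Z \<in> even_on n m"
proof -
  have "({..<n} - Z) \<inter> {..<m} = {..<m} - Z \<inter> {..<m}" using assms(2) by auto
  also have "card \<dots> = m - card (Z \<inter> {..<m})" by (subst card_Diff_subset) auto
  finally have "even (card (({..<n} - Z) \<inter> {..<m}))"
    using assms(1,3) by (simp add: even_on_def)
  then show ?thesis by (simp add: even_on_def)
qed

text \<open>
  Any single coordinate \<open>t\<close> of the parity check can be chosen for the correction of the signs, hence in particular
  the cheapest one.
\<close>

lemma even_on_loss: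
  fixes a :: "nat \<Rightarrow> real"
  assumes "\<And>i. 0 \<le> a i" "Z \<subseteq> {..<n}" "t < m" "m \<le> n"
    and C: "\<And>T. T \<subseteq> {..<n} \<Longrightarrow> sym_diff Z T \<in> even_on n m \<Longrightarrow> (\<Sum>i<n. a i) - 2 * (\<Sum>i\<in>T. a i) \<le> h"
  shows "(\<Sum>i<n. a i) - 2 * a t \<le> h"
proof (cases "Z \<in> even_on n m")
  case True
  then have "(\<Sum>i<n. a i) \<le> h" using C[of "{}"] by simp
  then show ?thesis using assms(1)[of t] by simp
next
  case False
  then have "sym_diff Z {t} \<in> even_on n m" using even_on_flip[OF assms(2-4)] by blast
  moreover have "{t} \<subseteq> {..<n}" using assms(3,4) by simp
  ultimately show ?thesis using C[of "{t}"] by simp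
qed

section \<open>Passing to the decreasing rearrangement\<close>

text \<open>
  The constraints refer to index sets, so the rearrangement is given by a permutation of the indices.
\<close>

lemma decreasing_rearrangement:
  fixes a :: "nat \<Rightarrow> real"
  obtains p where "bij_betw p {..<n} {..<n}" "\<And>i j. i \<le> j \<Longrightarrow> j < n \<Longrightarrow> a (p j) \<le> a (p i)"
proof -
  define xs where "xs = sort_key (\<lambda>i. - a i) [0..<n]"
  have xs: "set xs = {..<n}" "distinct xs" "length xs = n" "sorted (map (\<lambda>i. - a i) xs)"
    by (auto simp: xs_def)
  have "bij_betw (\<lambda>i. xs ! i) {..<n} {..<n}"
    by (rule bij_betw_nth[OF xs(2)]) (simp_all only: xs(1,3))
  moreover have "a (xs ! j) \<le> a (xs ! i)" if "i \<le> j" "j < n" for i j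
  proof -
    have "map (\<lambda>i. - a i) xs ! i \<le> map (\<lambda>i. - a i) xs ! j"
      by (rule sorted_nth_mono[OF xs(4) that(1)]) (simp only: length_map xs(3) that(2))
    moreover have "i < length xs" "j < length xs" using that by (simp_all only: xs(3))
    ultimately show ?thesis by (simp only: nth_map neg_le_iff_le)
  qed
  ultimately show thesis by (rule that)
qed

lemma sum_last_le_sum_subset:
  fixes z :: "nat \<Rightarrow> real"
  assumes z: "\<And>i j. i \<le> j \<Longrightarrow> j < N \<Longrightarrow> z j \<le> z i" and I: "I \<subseteq> {..<N}"
  shows "(\<Sum>i\<in>{N - card I..<N}. z i) \<le> (\<Sum>i\<in>I. z i)"
  using assms
proof (induction N arbitrary: I)
  case (Suc N)
  have fin: "finite I" using Suc.prems(2) finite_subset by blast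
  have mono: "\<And>i j. i \<le> j \<Longrightarrow> j < N \<Longrightarrow> z j \<le> z i" using Suc.prems(1) by simp
  show ?case
  proof (cases "N \<in> I")
    case True
    define I' where "I' = I - {N}"
    have "I' \<subseteq> {..<N}" using Suc.prems(2) by (auto simp: I'_def)
    from Suc.IH[OF mono this] have "(\<Sum>i\<in>{N - card I'..<N}. z i) \<le> (\<Sum>i\<in>I'. z i)" by simp
    moreover have "card I = Suc (card I')" unfolding I'_def by (rule card.remove[OF fin True])
    moreover have "(\<Sum>i\<in>I. z i) = z N + (\<Sum>i\<in>I'. z i)" unfolding I'_def by (rule sum.remove[OF fin True])
    ultimately show ?thesis by simp
  next
    case False
    then have sub: "I \<subseteq> {..<N}" using Suc.prems(2) by (auto simp: less_Suc_eq)
    have "(\<Sum>i\<in>{Suc N - card I..<Suc N}. z i) = (\<Sum>i\<in>{N - card I..<N}. z (Suc i))"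
    proof -
      have "card I \<le> N" using card_mono[OF _ sub] by simp
      then show ?thesis by (simp only: Suc_diff_le sum.shift_bounds_Suc_ivl)
    qed
    also have "\<dots> \<le> (\<Sum>i\<in>{N - card I..<N}. z i)"
      using Suc.prems(1) by (intro sum_mono) auto
    also have "\<dots> \<le> (\<Sum>i\<in>I. z i)" using Suc.IH[OF mono sub] .
    finally show ?thesis .
  qed
qed simp

lemma k_sets_sorted:
  assumes p: "bij_betw p {..<n} {..<n}" and k: "k \<le> n"
    and F: "\<And>S. S \<in> k_sets n k \<Longrightarrow> (\<Sum>i\<in>S. a i) \<le> sqrt (card S)"
  shows "(\<Sum>i<k. a (p i)) \<le> sqrt k"
proof -
  have sub: "{..<k} \<subseteq> {..<n}" using k by auto
  have inj: "inj_on p {..<k}" using p sub by (auto simp: bij_betw_def intro: inj_on_subset)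
  have c: "card (p ` {..<k}) = k" using inj by (simp add: card_image)
  have "p ` {..<k} \<in> k_sets n k" using p sub c by (auto simp: k_sets_def bij_betw_def)
  from F[OF this] show ?thesis using inj c by (simp add: sum.reindex)
qed

text \<open>
  Among the \<open>2 * k - 1\<close> largest coordinates, some \<open>k\<close> lie in the same part. Their sum is at most \<open>sqrt k\<close>, and it
  is at least the sum of the \<open>k\<close> smallest of the \<open>2 * k - 1\<close>.
\<close>

lemma split_sets_sorted:
  assumes p: "bij_betw p {..<n} {..<n}" and dec: "\<And>i j. i \<le> j \<Longrightarrow> j < n \<Longrightarrow> a (p j) \<le> a (p i)"
    and k: "0 < k" "2 * k - 1 \<le> n"
    and F: "\<And>S. S \<in> split_sets n h k \<Longrightarrow> (\<Sum>i\<in>S. a i) \<le> sqrt (card S)"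
  shows "(\<Sum>i\<in>{k - 1..<2 * k - 1}. a (p i)) \<le> sqrt k"
proof -
  define A B where "A = {i. i < 2 * k - 1 \<and> p i < h}" and "B = {i. i < 2 * k - 1 \<and> \<not> p i < h}"
  have AB: "finite A" "finite B" "A \<inter> B = {}" "A \<union> B = {..<2 * k - 1}" by (auto simp: A_def B_def)
  then have "card A + card B = 2 * k - 1" by (metis card_Un_disjoint card_lessThan)
  then have "k \<le> card A \<or> k \<le> card B" using k by linarith
  then obtain I where I: "I \<subseteq> A \<or> I \<subseteq> B" "card I = k"
    by (metis obtain_subset_with_card_n)
  have sub: "I \<subseteq> {..<2 * k - 1}" using I(1) AB(4) by blast
  have In: "I \<subseteq> {..<n}" using sub k by auto
  then have inj: "inj_on p I" by (rule inj_on_subset[OF bij_betw_imp_inj_on[OF p]])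
  have c: "card (p ` I) = k" using inj I(2) by (simp add: card_image)
  have pn: "p i < n" if "i \<in> I" for i using bij_betw_apply[OF p, of i] In that by auto
  have "p ` I \<subseteq> {..<h} \<or> p ` I \<subseteq> {h..<n}" using I(1) pn by (auto simp: A_def B_def not_less)
  then have "p ` I \<in> split_sets n h k" using c by (simp add: split_sets_def)
  from F[OF this] have "(\<Sum>i\<in>I. a (p i)) \<le> sqrt k" using inj c by (simp add: sum.reindex)
  moreover have "(\<Sum>i\<in>{2 * k - 1 - card I..<2 * k - 1}. a (p i)) \<le> (\<Sum>i\<in>I. a (p i))"
    using dec k sub by (intro sum_last_le_sum_subset[where z = "\<lambda>i. a (p i)"]) auto
  moreover have "2 * k - 1 - card I = k - 1" using I(2) k by simp
  ultimately show ?thesis by simp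
qed

text \<open>
  At most one coordinate lies outside the parity check, so some sorted position from \<open>m - 1\<close> on carries a
  coordinate at which the sign may be changed.
\<close>

lemma even_on_sorted:
  fixes a :: "nat \<Rightarrow> real"
  assumes p: "bij_betw p {..<n} {..<n}" and dec: "\<And>i j. i \<le> j \<Longrightarrow> j < n \<Longrightarrow> a (p j) \<le> a (p i)"
    and a: "\<And>i. 0 \<le> a i" and Z: "Z \<subseteq> {..<n}" and m: "m \<le> n" "n \<le> m + 1" "2 \<le> n"
    and C: "\<And>T. T \<subseteq> {..<n} \<Longrightarrow> sym_diff Z T \<in> even_on n m \<Longrightarrow> (\<Sum>i<n. a i) - 2 * (\<Sum>i\<in>T. a i) \<le> h"
  shows "(\<Sum>i<n. a (p i)) - 2 * a (p (m - 1)) \<le> h"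
proof -
  have reindex: "(\<Sum>i<n. a (p i)) = (\<Sum>i<n. a i)" using sum.reindex_bij_betw[OF p] .
  have pn: "p i < n" if "i < n" for i using p that by (auto simp: bij_betw_def)
  obtain i where i: "m - 1 \<le> i" "i < n" "p i < m"
  proof (cases "p (n - 1) < m")
    case True
    then show thesis using that[of "n - 1"] m by simp
  next
    case False
    then have "p (n - 1) = m" "n = m + 1" using pn[of "n - 1"] m by auto
    moreover have "p (n - 2) \<noteq> p (n - 1)"
      using inj_onD[OF bij_betw_imp_inj_on[OF p], of "n - 2" "n - 1"] m by auto
    moreover have "p (n - 2) < n" using pn[of "n - 2"] m by simp
    ultimately have "p (n - 2) < m" by linarith
    then show thesis using that[of "n - 2"] \<open>n = m + 1\<close> m by simp
  qed
  have "(\<Sum>i<n. a i) - 2 * a (p i) \<le> h" using even_on_loss[OF a Z i(3) m(1) C] .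
  moreover have "a (p i) \<le> a (p (m - 1))" using dec[of "m - 1" i] i by simp
  ultimately show ?thesis unfolding reindex by simp
qed

lemma sum_Un_le: "finite A \<Longrightarrow> finite B \<Longrightarrow> sum f (A \<union> B) \<le> sum f A + sum f B" for f :: "'a \<Rightarrow> nat"
  using sum.union_inter[of A B f] by linarith

lemma sum_UN_le:
  fixes f :: "'a \<Rightarrow> nat"
  assumes "finite K" "\<And>k. k \<in> K \<Longrightarrow> finite (F k)" "\<And>k. k \<in> K \<Longrightarrow> sum f (F k) \<le> g k"
  shows "sum f (\<Union>k\<in>K. F k) \<le> sum g K"
  using assms
proof (induction K rule: finite_induct)
  case (insert k K)
  have "sum f (\<Union>k\<in>insert k K. F k) \<le> sum f (F k) + sum f (\<Union>k\<in>K. F k)"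
    using sum_Un_le[of "F k" "\<Union>k\<in>K. F k" f] insert by simp
  also have "\<dots> \<le> g k + sum g K" using insert by (intro add_mono) auto
  finally show ?case using insert by simp
qed simp

text \<open>
  Supports are all \<open>k\<close>-sets for \<open>k \<in> K\<close> and the \<open>k\<close>-sets inside the two parts \<open>{..<h}\<close> and \<open>{h..<n}\<close> for
  \<open>k \<in> L\<close>. The predicate \<open>loss\<close> stands for whatever the code \<open>C\<close> implies for the sorted sequence, so that parity
  codes and the code of dimension 15 are covered together.
\<close>

theorem w_le_of_code:
  fixes K L :: "nat set" and C :: "nat set set"
  assumes n: "CARD('n::finite) = n" "2 \<le> n"
    and K: "finite K" "\<And>k. k \<in> K \<Longrightarrow> 0 < k \<and> k \<le> n"
    and L: "finite L" "\<And>k. k \<in> L \<Longrightarrow> 0 < k \<and> 2 * k - 1 \<le> n" "h \<le> n"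
    and C: "\<And>Z. Z \<in> C \<Longrightarrow> Z \<subseteq> {..<n}" "\<And>Z. Z \<in> C \<Longrightarrow> {..<n} - Z \<in> C"
    and card: "(\<Sum>k\<in>K. 2 ^ k * (n choose k)) + (\<Sum>k\<in>L. 2 ^ k * ((h choose k) + ((n - h) choose k))) + card C \<le> N"
    and loss: "\<And>a p Z. bij_betw p {..<n} {..<n} \<Longrightarrow> (\<And>i j. i \<le> j \<Longrightarrow> j < n \<Longrightarrow> a (p j) \<le> a (p i)) \<Longrightarrow> (\<And>i. 0 \<le> a i) \<Longrightarrow>
      Z \<subseteq> {..<n} \<Longrightarrow> (\<And>T. T \<subseteq> {..<n} \<Longrightarrow> sym_diff Z T \<in> C \<Longrightarrow> (\<Sum>i<n. a i) - 2 * (\<Sum>i\<in>T. a i) \<le> sqrt n) \<Longrightarrow>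
      loss (\<lambda>i. a (p i))"
    and bound: "\<And>z. (\<And>i j. i \<le> j \<Longrightarrow> j < n \<Longrightarrow> z j \<le> z i) \<Longrightarrow> (\<And>i. 0 \<le> z i) \<Longrightarrow>
      (\<And>k. k \<in> K \<Longrightarrow> (\<Sum>i<k. z i) \<le> sqrt k) \<Longrightarrow> (\<And>k. k \<in> L \<Longrightarrow> (\<Sum>i\<in>{k - 1..<2 * k - 1}. z i) \<le> sqrt k) \<Longrightarrow>
      loss z \<Longrightarrow> (\<Sum>i<n. (z i)\<^sup>2) \<le> 2 * real n / (real n - 1)"
  shows "w TYPE('n) \<le> N"
proof -
  define F where "F = (\<Union>k\<in>K. k_sets n k) \<union> (\<Union>k\<in>L. split_sets n h k)"
  show ?thesis
  proof (rule w_le_of_sets[OF n, of F C])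
    show "S \<subseteq> {..<n} \<and> S \<noteq> {}" if "S \<in> F" for S
      using that K(2) L(2,3) by (fastforce simp: F_def k_sets_def split_sets_def)
    show "Z \<subseteq> {..<n}" "{..<n} - Z \<in> C" if "Z \<in> C" for Z using C that by auto
    have "(\<Sum>S\<in>F. 2 ^ card S) \<le> (\<Sum>S\<in>(\<Union>k\<in>K. k_sets n k). 2 ^ card S) + (\<Sum>S\<in>(\<Union>k\<in>L. split_sets n h k). (2::nat) ^ card S)"
      unfolding F_def using K(1) L(1,3) by (intro sum_Un_le) (auto simp: finite_k_sets finite_split_sets)
    also have "\<dots> \<le> (\<Sum>k\<in>K. 2 ^ k * (n choose k)) + (\<Sum>k\<in>L. 2 ^ k * ((h choose k) + ((n - h) choose k)))"
      using K(1) L(1,3) by (intro add_mono sum_UN_le) (auto simp: finite_k_sets finite_split_sets weight_k_sets weight_split_sets)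
    finally show "(\<Sum>S\<in>F. 2 ^ card S) + card C \<le> N" using card by linarith
    fix a :: "nat \<Rightarrow> real" and Z
    assume a: "\<And>i. 0 \<le> a i" and F: "\<And>S. S \<in> F \<Longrightarrow> (\<Sum>i\<in>S. a i) \<le> sqrt (card S)" and Z: "Z \<subseteq> {..<n}"
      and T: "\<And>T. T \<subseteq> {..<n} \<Longrightarrow> sym_diff Z T \<in> C \<Longrightarrow> (\<Sum>i<n. a i) - 2 * (\<Sum>i\<in>T. a i) \<le> sqrt n"
    obtain p where p: "bij_betw p {..<n} {..<n}" and dec: "\<And>i j. i \<le> j \<Longrightarrow> j < n \<Longrightarrow> a (p j) \<le> a (p i)"
      using decreasing_rearrangement[of n a] by metis
    have "(\<Sum>i<n. (a (p i))\<^sup>2) \<le> 2 * real n / (real n - 1)"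
    proof (rule bound[of "\<lambda>i. a (p i)"])
      show "(\<Sum>i<k. a (p i)) \<le> sqrt k" if "k \<in> K" for k
      proof (rule k_sets_sorted[OF p])
        show "k \<le> n" using K(2) that by simp
        show "(\<Sum>i\<in>S. a i) \<le> sqrt (card S)" if "S \<in> k_sets n k" for S
          using F[of S] that \<open>k \<in> K\<close> by (auto simp: F_def)
      qed
      show "(\<Sum>i\<in>{k - 1..<2 * k - 1}. a (p i)) \<le> sqrt k" if "k \<in> L" for k
      proof (rule split_sets_sorted[of p n a, OF p dec])
        show "0 < k" "2 * k - 1 \<le> n" using L(2)[OF that] by auto
        show "(\<Sum>i\<in>S. a i) \<le> sqrt (card S)" if "S \<in> split_sets n h k" for S
          using F[of S] that \<open>k \<in> L\<close> by (auto simp: F_def)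
      qed
      show "loss (\<lambda>i. a (p i))" by (rule loss[of p a Z, OF p dec a Z T])
    qed (use dec a in auto)
    also have "(\<Sum>i<n. (a (p i))\<^sup>2) = (\<Sum>i<n. (a i)\<^sup>2)" using sum.reindex_bij_betw[OF p] .
    finally show "(\<Sum>i<n. (a i)\<^sup>2) \<le> 2 * real n / (real n - 1)" .
  qed
qed

corollary w_le_of_parity:
  fixes K L :: "nat set"
  assumes n: "CARD('n::finite) = n" "2 \<le> n"
    and K: "finite K" "\<And>k. k \<in> K \<Longrightarrow> 0 < k \<and> k \<le> n"
    and L: "finite L" "\<And>k. k \<in> L \<Longrightarrow> 0 < k \<and> 2 * k - 1 \<le> n" "h \<le> n"
    and m: "even m" "0 < m" "m \<le> n" "n \<le> m + 1"
    and card: "(\<Sum>k\<in>K. 2 ^ k * (n choose k)) + (\<Sum>k\<in>L. 2 ^ k * ((h choose k) + ((n - h) choose k))) + 2 ^ (n - 1) \<le> N"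
    and bound: "\<And>z. (\<And>i j. i \<le> j \<Longrightarrow> j < n \<Longrightarrow> z j \<le> z i) \<Longrightarrow> (\<And>i. 0 \<le> z i) \<Longrightarrow>
      (\<And>k. k \<in> K \<Longrightarrow> (\<Sum>i<k. z i) \<le> sqrt k) \<Longrightarrow> (\<And>k. k \<in> L \<Longrightarrow> (\<Sum>i\<in>{k - 1..<2 * k - 1}. z i) \<le> sqrt k) \<Longrightarrow>
      (\<Sum>i<n. z i) - 2 * z (m - 1) \<le> sqrt n \<Longrightarrow> (\<Sum>i<n. (z i)\<^sup>2) \<le> 2 * real n / (real n - 1)"
  shows "w TYPE('n) \<le> N"
proof (rule w_le_of_code[OF n K(1) K(2) L(1) L(2) L(3), where C = "even_on n m" and loss = "\<lambda>z. (\<Sum>i<n. z i) - 2 * z (m - 1) \<le> sqrt n"])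
  show "Z \<subseteq> {..<n}" if "Z \<in> even_on n m" for Z using that by (simp add: even_on_def)
  show "{..<n} - Z \<in> even_on n m" if "Z \<in> even_on n m" for Z using even_on_compl m that by blast
  show "(\<Sum>k\<in>K. 2 ^ k * (n choose k)) + (\<Sum>k\<in>L. 2 ^ k * ((h choose k) + ((n - h) choose k))) + card (even_on n m) \<le> N"
    using card m by (simp add: card_even_on)
next
  fix a p Z
  assume "bij_betw p {..<n} {..<n}" "\<And>i j. i \<le> j \<Longrightarrow> j < n \<Longrightarrow> a (p j) \<le> a (p i)" "\<And>i. 0 \<le> a i" "Z \<subseteq> {..<n}"
    "\<And>T. T \<subseteq> {..<n} \<Longrightarrow> sym_diff Z T \<in> even_on n m \<Longrightarrow> (\<Sum>i<n. a i) - 2 * (\<Sum>i\<in>T. a i) \<le> sqrt n"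
  then show "(\<Sum>i<n. a (p i)) - 2 * a (p (m - 1)) \<le> sqrt n"
    using m n by (intro even_on_sorted) auto
next
  fix z
  assume "\<And>i j. i \<le> j \<Longrightarrow> j < n \<Longrightarrow> z j \<le> z i" "\<And>i. 0 \<le> z i" "\<And>k. k \<in> K \<Longrightarrow> (\<Sum>i<k. z i) \<le> sqrt k"
    "\<And>k. k \<in> L \<Longrightarrow> (\<Sum>i\<in>{k - 1..<2 * k - 1}. z i) \<le> sqrt k" "(\<Sum>i<n. z i) - 2 * z (m - 1) \<le> sqrt n"
  then show "(\<Sum>i<n. (z i)\<^sup>2) \<le> 2 * real n / (real n - 1)" by (rule bound)
qed

section \<open>Squares of the small coordinates\<close>

lemma sum_split_at: "k \<le> n \<Longrightarrow> (\<Sum>i<n. f i) = (\<Sum>i<k. f i) + (\<Sum>i\<in>{k..<n}. (f i :: real))" for k n :: nat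
  using sum.atLeastLessThan_concat[of 0 k n f] by (simp add: atLeast0LessThan)

lemma sum_numerals_unfold:
  fixes f :: "nat \<Rightarrow> real"
  shows "(\<Sum>i<2. f i) = f 0 + f 1" "(\<Sum>i<3. f i) = f 0 + f 1 + f 2"
    "(\<Sum>i<4. f i) = f 0 + f 1 + f 2 + f 3"
    "(\<Sum>i<6. f i) = f 0 + f 1 + f 2 + f 3 + f 4 + f 5" "(\<Sum>i<7. f i) = f 0 + f 1 + f 2 + f 3 + f 4 + f 5 + f 6"
    "(\<Sum>i\<in>{2..<5}. f i) = f 2 + f 3 + f 4" "(\<Sum>i\<in>{3..<7}. f i) = f 3 + f 4 + f 5 + f 6"
  by (simp_all add: eval_nat_numeral)

lemma sum_lessThan_5: "(\<Sum>i<5. f i) = f 0 + f 1 + f 2 + f 3 + f 4" for f :: "nat \<Rightarrow> 'a::comm_monoid_add"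
  by (simp add: eval_nat_numeral)

text \<open>
  The square roots occur on the larger side of the constraints, so replacing them by rational upper bounds is
  legitimate, and it turns the quadratic inequalities below into problems with rational coefficients. Four decimals
  leave enough room, except in dimension 7, where equality occurs and \<open>sqrt 3\<close> is kept.
\<close>

lemma sqrt_bounds:
  "sqrt 2 \<le> 14143 / 10000" "sqrt 3 \<le> 17321 / 10000" "sqrt 6 \<le> 24495 / 10000" "sqrt 8 \<le> 28285 / 10000"
  "sqrt 10 \<le> 31623 / 10000" "sqrt 11 \<le> 33167 / 10000" "sqrt 12 \<le> 34642 / 10000" "sqrt 13 \<le> 36056 / 10000"
  "sqrt 14 \<le> 37417 / 10000" "sqrt 15 \<le> 38730 / 10000"
  by (rule real_le_lsqrt; simp add: power2_eq_square; fail)+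

text \<open>
  On an interval a convex function lies below its chord.
\<close>

lemma sum_squares_between:
  fixes z :: "nat \<Rightarrow> real" and m u :: real
  assumes "\<And>i. i \<in> B \<Longrightarrow> m \<le> z i" "\<And>i. i \<in> B \<Longrightarrow> z i \<le> u"
  shows "(\<Sum>i\<in>B. (z i)\<^sup>2) \<le> (u + m) * (\<Sum>i\<in>B. z i) - card B * (u * m)"
proof -
  have "(\<Sum>i\<in>B. (z i)\<^sup>2) \<le> (\<Sum>i\<in>B. (u + m) * z i - u * m)"
  proof (rule sum_mono)
    fix i assume "i \<in> B"
    then have "0 \<le> (z i - m) * (u - z i)" using assms by simp
    then show "(z i)\<^sup>2 \<le> (u + m) * z i - u * m" by (simp add: algebra_simps power2_eq_square)
  qed
  then show ?thesis by (simp add: sum_subtractf sum_distrib_left)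
qed

text \<open>
  The entry \<open>z p\<close> is the one whose sign has been changed, and \<open>T\<close> is the resulting signed sum of the entries from
  \<open>k\<close> on. The entries before position \<open>p\<close> lie between \<open>z p\<close> and \<open>u\<close>, so the chord bound applies to them; the
  squares after position \<open>p\<close> are at most \<open>z p\<close> times the entries. If there were no loss, the bound would be
  \<open>u * T\<close>; the second summand corrects for \<open>z p > 0\<close>. That \<open>z k \<le> T\<close> holds because the entry following \<open>z k\<close>
  outweighs \<open>z p\<close>.
\<close>

lemma tail_bound:
  fixes z :: "nat \<Rightarrow> real"
  assumes dec: "\<And>i j. i \<le> j \<Longrightarrow> j < n \<Longrightarrow> z j \<le> z i" and nonneg: "\<And>i. 0 \<le> z i"
    and kp: "k < p" "p < n" and u: "z k \<le> u"
    and T: "T = (\<Sum>i\<in>{k..<n}. z i) - 2 * z p"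
  shows "(\<Sum>i\<in>{k..<n}. (z i)\<^sup>2) \<le> u * T + z p * (T + 2 * z p - (real (p - k) - 1) * u)"
    and "k + 2 \<le> p \<Longrightarrow> z k \<le> T"
proof -
  have split: "(\<Sum>i\<in>{k..<n}. f i) = (\<Sum>i\<in>{k..<p}. f i) + f p + (\<Sum>i\<in>{Suc p..<n}. f i)" for f :: "nat \<Rightarrow> real"
    using kp sum.atLeastLessThan_concat[of k p n f] sum.atLeast_Suc_lessThan[of p n f] by simp
  define S W where "S = (\<Sum>i\<in>{k..<p}. z i)" and "W = (\<Sum>i\<in>{Suc p..<n}. z i)"
  have T': "T = S - z p + W" unfolding T split[of z] S_def W_def by simp
  have W0: "0 \<le> W" unfolding W_def by (intro sum_nonneg nonneg)
  have "(\<Sum>i\<in>{k..<p}. (z i)\<^sup>2) \<le> (u + z p) * S - card {k..<p} * (u * z p)"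
    unfolding S_def
  proof (rule sum_squares_between[where z = z and m = "z p" and u = u and B = "{k..<p}"])
    show "z p \<le> z i" if "i \<in> {k..<p}" for i using dec[of i p] that kp by simp
    show "z i \<le> u" if "i \<in> {k..<p}" for i using dec[of k i] that kp u by simp
  qed
  moreover have "(\<Sum>i\<in>{Suc p..<n}. (z i)\<^sup>2) \<le> z p * W"
    unfolding W_def sum_distrib_left power2_eq_square
    using dec nonneg by (intro sum_mono mult_right_mono) auto
  ultimately have "(\<Sum>i\<in>{k..<n}. (z i)\<^sup>2) \<le> (u + z p) * S - real (p - k) * (u * z p) + (z p)\<^sup>2 + z p * W"
    unfolding split[of "\<lambda>i. (z i)\<^sup>2"] by simp
  also have "\<dots> = u * T + z p * (T + 2 * z p - (real (p - k) - 1) * u) - u * W"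
    unfolding T' by (simp add: algebra_simps power2_eq_square)
  also have "\<dots> \<le> u * T + z p * (T + 2 * z p - (real (p - k) - 1) * u)"
    using W0 nonneg[of k] u by simp
  finally show "(\<Sum>i\<in>{k..<n}. (z i)\<^sup>2) \<le> u * T + z p * (T + 2 * z p - (real (p - k) - 1) * u)" .
  assume k2: "k + 2 \<le> p"
  have "z k + z (Suc k) \<le> S"
  proof -
    have "(\<Sum>i\<in>{k, Suc k}. z i) \<le> S" unfolding S_def
      using k2 nonneg by (intro sum_mono2) auto
    then show ?thesis by simp
  qed
  moreover have "z p \<le> z (Suc k)" using dec[of "Suc k" p] k2 kp by simp
  ultimately show "z k \<le> T" using T' W0 by linarith
qed

text \<open>
  The form in which the tail bound is applied: the signed sum of all entries is known to be at most \<open>h\<close>, so a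
  larger head leaves less for the tail.
\<close>

lemma tail_bound_head:
  fixes z :: "nat \<Rightarrow> real"
  assumes dec: "\<And>i j. i \<le> j \<Longrightarrow> j < n \<Longrightarrow> z j \<le> z i" and nonneg: "\<And>i. 0 \<le> z i"
    and kp: "k < p" "p < n" and u: "z k \<le> u"
    and h: "(\<Sum>i<n. z i) - 2 * z p \<le> h" and T: "T = h - (\<Sum>i<k. z i)"
  shows "(\<Sum>i<n. (z i)\<^sup>2) \<le> (\<Sum>i<k. (z i)\<^sup>2) + (u * T + z p * (T + 2 * z p - (real (p - k) - 1) * u))"
    and "k + 2 \<le> p \<Longrightarrow> z k \<le> T" and "0 \<le> z p" and "z p \<le> u"
proof -
  define T' where "T' = (\<Sum>i\<in>{k..<n}. z i) - 2 * z p"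
  have "k \<le> n" using kp by simp
  then have "T' \<le> T" using h unfolding T T'_def sum_split_at[OF \<open>k \<le> n\<close>, of z] by simp
  moreover have *: "(\<Sum>i\<in>{k..<n}. (z i)\<^sup>2) \<le> u * T' + z p * (T' + 2 * z p - (real (p - k) - 1) * u)"
    "k + 2 \<le> p \<Longrightarrow> z k \<le> T'"
    using tail_bound[OF dec nonneg kp u T'_def] by auto
  moreover have u0: "0 \<le> u" using u nonneg[of k] by linarith
  ultimately have "(\<Sum>i\<in>{k..<n}. (z i)\<^sup>2) \<le> u * T + z p * (T + 2 * z p - (real (p - k) - 1) * u)"
    using nonneg[of p] by (smt (verit) mult_left_mono)
  then show "(\<Sum>i<n. (z i)\<^sup>2) \<le> (\<Sum>i<k. (z i)\<^sup>2) + (u * T + z p * (T + 2 * z p - (real (p - k) - 1) * u))"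
    unfolding sum_split_at[OF \<open>k \<le> n\<close>, of "\<lambda>i. (z i)\<^sup>2"] by simp
  show "z k \<le> T" if "k + 2 \<le> p" using *(2)[OF that] \<open>T' \<le> T\<close> by simp
  show "0 \<le> z p" by (rule nonneg)
  show "z p \<le> u" using dec[of k p] kp u by simp
qed

text \<open>
  The correction term is convex in the lost entry \<open>m\<close>, so it is largest at one of the two ends \<open>m = 0\<close> and
  \<open>m = u\<close>; at the former it vanishes.
\<close>

lemma convex_in_loss:
  fixes m :: real
  assumes "0 \<le> m" "m \<le> u"
  shows "m * (X + 2 * m) \<le> max 0 (u * (X + 2 * u))"
proof (cases "X + 2 * m \<le> 0")
  case True
  then show ?thesis using assms(1) by (simp add: mult_nonneg_nonpos le_max_iff_disj)
next
  case False
  then have "m * (X + 2 * m) \<le> u * (X + 2 * u)"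
    using assms by (intro mult_mono) auto
  then show ?thesis by simp
qed

text \<open>
  When the tail starts with its own largest entry \<open>v\<close>, the inequality \<open>v \<le> T\<close> is available, and the correction is at most
  \<open>v * (T - v)\<close> for every value of the lost entry.
\<close>

lemma tail_bound_sharp:
  fixes v m T q :: real
  assumes "0 \<le> m" "m \<le> v" "v \<le> T" "4 \<le> q"
  shows "v * T + m * (T + 2 * m - q * v) \<le> 2 * v * T - v\<^sup>2"
proof -
  have "m * (T + 2 * m - q * v) \<le> v * (T - v)"
  proof (cases "T + 2 * m - q * v \<le> 0")
    case True
    then show ?thesis using assms by (smt (verit) mult_nonneg_nonneg mult_nonneg_nonpos)
  next
    case False
    have "4 * v \<le> q * v" using assms by (intro mult_right_mono) auto
    then have "T + 2 * m - q * v \<le> T - v" using assms by linarith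
    then show ?thesis using assms False by (intro mult_mono) auto
  qed
  then show ?thesis by (simp add: algebra_simps power2_eq_square)
qed

section \<open>Dimension 5\<close>

text \<open>
  The constraints are those of the axes, of \<open>(3, 0, 4) / 5\<close>, \<open>(0, 3, 4) / 5\<close> and \<open>(2, 2, 1) / 3\<close>. By the symmetry
  in \<open>x\<close> and \<open>y\<close> one may assume \<open>y \<le> x\<close>. The value \<open>57 / 43\<close> is what the products listed in the proof yield; it
  exceeds the maximum \<open>21 / 16\<close>, attained at \<open>(1, 1 / 4, 1 / 2)\<close>, by little enough for dimension 5.
\<close>

lemma ball3_quadratic:
  fixes x y t :: real
  assumes "0 \<le> x" "0 \<le> y" "0 \<le> t" "x \<le> 1" "y \<le> 1" "t \<le> 1"
    and "3 * x + 4 * t \<le> 5" "3 * y + 4 * t \<le> 5" "2 * x + 2 * y + t \<le> 3"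
  shows "x\<^sup>2 + y\<^sup>2 + t\<^sup>2 \<le> 57 / 43"
proof -
  have sorted: "x\<^sup>2 + y\<^sup>2 + t\<^sup>2 \<le> 57 / 43"
    if "0 \<le> y" "y \<le> x" "0 \<le> t" "x \<le> 1" "t \<le> 1" "3 * x + 4 * t \<le> 5" "2 * x + 2 * y + t \<le> 3" for x y t :: real
  proof -
    have "0 \<le> (1 - x) * (x - y)" "0 \<le> (1 - x) * (1 - t)" "0 \<le> (x - y) * y" "0 \<le> (x - y) * (5 - 3 * x - 4 * t)"
      "0 \<le> y * (5 - 3 * x - 4 * t)" "0 \<le> y * (3 - 2 * x - 2 * y - t)" "0 \<le> t * (5 - 3 * x - 4 * t)"
      "0 \<le> (1 - t) * (3 - 2 * x - 2 * y - t)"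
      using that by (intro mult_nonneg_nonneg; simp)+
    then show ?thesis by (simp add: algebra_simps power2_eq_square)
  qed
  show ?thesis
    using sorted[of y x t] sorted[of x y t] assms by (cases "y \<le> x") auto
qed

text \<open>
  The polar body of the regular octagon has its vertices at \<open>(1, sqrt 2 - 1)\<close> and \<open>(sqrt 2 - 1, 1)\<close> in the
  positive quadrant.
\<close>

lemma octagon_quadratic:
  fixes s t :: real
  assumes "0 \<le> s" "0 \<le> t" "s \<le> 1" "t \<le> 1" "s + t \<le> 14143/10000"
  shows "s\<^sup>2 + t\<^sup>2 \<le> 1 + (4143/10000)\<^sup>2"
proof -
  have "s\<^sup>2 + t\<^sup>2 \<le> 1 \<or> s\<^sup>2 + t\<^sup>2 \<le> 1 + (s + t - 1)\<^sup>2 \<and> 0 \<le> s + t - 1"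
  proof (cases "s + t \<le> 1")
    case True
    then have "(s + t)\<^sup>2 \<le> 1" using assms by (simp add: power_le_one)
    moreover have "0 \<le> 2 * s * t" using assms by simp
    ultimately show ?thesis by (simp add: power2_sum)
  next
    case False
    have "0 \<le> (1 - s) * (1 - t)" using assms by simp
    then show ?thesis using False by (simp add: algebra_simps power2_eq_square)
  qed
  moreover have "(s + t - 1)\<^sup>2 \<le> (4143/10000)\<^sup>2" if "0 \<le> s + t - 1"
    using that assms by (intro power_mono) auto
  moreover have "(1::real) \<le> 1 + (4143/10000)\<^sup>2" by simp
  ultimately show ?thesis by linarith
qed

text \<open>
  The coordinates 0, 1, 2 and the coordinates 3, 4 are constrained separately; the sums of squares allowed in the
  two factors add up to less than \<open>5 / 2\<close>.
\<close>

definition patterns5 :: "real list list" where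
  "patterns5 = [[1,0,0,0,0], [0,1,0,0,0], [0,0,1,0,0], [0,0,0,1,0], [0,0,0,0,1],
    [3/5,0,4/5,0,0], [0,3/5,4/5,0,0], [2/3,2/3,1/3,0,0], [0,0,0,1/sqrt 2,1/sqrt 2]]"

lemma card_conv_sum_of_bool: "card {i. i < n \<and> P i} = (\<Sum>i<n. of_bool (P i))" for n :: nat
proof -
  have "{..<n} \<inter> {i. P i} = {i. i < n \<and> P i}" by auto
  then show ?thesis by (simp add: sum_of_bool_eq)
qed

lemma w_5_le: "w TYPE(5) \<le> 30"
proof (rule w_le_of_patterns[where n = 5 and U = "nth ` set patterns5" and C = "{}"])
  show "finite (nth ` set patterns5)" by simp
  show "0 \<le> u i" if "u \<in> nth ` set patterns5" "i < 5" for u i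
  proof -
    have "i \<in> {0,1,2,3,4}" using that(2) by auto
    then show ?thesis using that(1) by (auto simp: patterns5_def)
  qed
  show "(\<Sum>i<5. (u i)\<^sup>2) = 1" if "u \<in> nth ` set patterns5" for u
    using that by (auto simp: patterns5_def sum_lessThan_5 power_divide)
  show "(\<Sum>u\<in>nth ` set patterns5. 2 ^ card {i. i < 5 \<and> u i \<noteq> 0}) + card ({} :: nat set set) \<le> 30"
  proof -
    have "(\<Sum>u\<in>nth ` set patterns5. 2 ^ card {i. i < 5 \<and> u i \<noteq> 0})
        \<le> (\<Sum>x\<in>set patterns5. (2::nat) ^ card {i. i < 5 \<and> x ! i \<noteq> 0})"
      using sum_image_le[of "set patterns5" "\<lambda>u. (2::nat) ^ card {i. i < 5 \<and> u i \<noteq> 0}" nth] by (simp add: o_def)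
    also have "\<dots> \<le> (\<Sum>x\<leftarrow>patterns5. (2::nat) ^ card {i. i < 5 \<and> x ! i \<noteq> 0})"
      by (rule sum_set_le_sum_list)
    also have "\<dots> = 30"
      unfolding card_conv_sum_of_bool sum_lessThan_5 by (simp add: patterns5_def)
    finally show ?thesis by simp
  qed
  fix a :: "nat \<Rightarrow> real" and Z
  assume a: "\<And>i. 0 \<le> a i" and u: "\<And>u. u \<in> nth ` set patterns5 \<Longrightarrow> (\<Sum>i<5. u i * a i) \<le> 1"
  have v: "(\<Sum>i<5. x ! i * a i) \<le> 1" if "x \<in> set patterns5" for x using u that by blast
  note simps = patterns5_def sum_lessThan_5
  have "a 0 \<le> 1" using v[of "[1,0,0,0,0]"] by (simp add: simps)
  moreover have "a 1 \<le> 1" using v[of "[0,1,0,0,0]"] by (simp add: simps)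
  moreover have "a 2 \<le> 1" using v[of "[0,0,1,0,0]"] by (simp add: simps)
  moreover have "a 3 \<le> 1" using v[of "[0,0,0,1,0]"] by (simp add: simps)
  moreover have "a 4 \<le> 1" using v[of "[0,0,0,0,1]"] by (simp add: simps)
  moreover have "3 * a 0 + 4 * a 2 \<le> 5" using v[of "[3/5,0,4/5,0,0]"] by (simp add: simps)
  moreover have "3 * a 1 + 4 * a 2 \<le> 5" using v[of "[0,3/5,4/5,0,0]"] by (simp add: simps)
  moreover have "2 * a 0 + 2 * a 1 + a 2 \<le> 3" using v[of "[2/3,2/3,1/3,0,0]"] by (simp add: simps)
  moreover have "a 3 + a 4 \<le> 14143/10000"
  proof -
    have "(a 3 + a 4) / sqrt 2 \<le> 1"
      using v[of "[0,0,0,1/sqrt 2,1/sqrt 2]"] by (simp add: simps add_divide_distrib)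
    then show ?thesis using sqrt_bounds(1) by (simp add: divide_le_eq)
  qed
  ultimately have "(a 0)\<^sup>2 + (a 1)\<^sup>2 + (a 2)\<^sup>2 \<le> 57 / 43" "(a 3)\<^sup>2 + (a 4)\<^sup>2 \<le> 1 + (4143/10000)\<^sup>2"
    using ball3_quadratic[of "a 0" "a 1" "a 2"] octagon_quadratic[of "a 3" "a 4"]
      a[of 0] a[of 1] a[of 2] a[of 3] a[of 4] by blast+
  then show "(\<Sum>i<5. (a i)\<^sup>2) \<le> 2 * real 5 / (real 5 - 1)"
    by (simp add: sum_lessThan_5 power2_eq_square)
qed auto

section \<open>Dimension 6\<close>

text \<open>
  Where the head \<open>a, b\<close> leaves at most \<open>2 * b\<close> for the signed tail sum, the tail is worst when it is concentrated
  in a single entry; otherwise it is enough that all the other entries are at most \<open>b\<close>.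
\<close>

lemma axes_quadratic_dim6:
  fixes a b c d e f :: real
  assumes "0 \<le> f" "f \<le> e" "e \<le> d" "d \<le> c" "c \<le> b" "b \<le> a" "a \<le> 1"
    and h: "a + b + c + d + e - f \<le> 24495/10000"
  shows "a\<^sup>2 + b\<^sup>2 + c\<^sup>2 + d\<^sup>2 + e\<^sup>2 + f\<^sup>2 \<le> 12 / 5"
proof (cases "24495/10000 \<le> a + 3 * b")
  case True
  define T where "T = 24495/10000 - a - b"
  have "c\<^sup>2 + d\<^sup>2 + e\<^sup>2 + f\<^sup>2 \<le> (c + d + e - f)\<^sup>2"
  proof -
    \<comment> \<open>Expanding \<open>(c + d + e - f)\<^sup>2\<close>, the mixed terms outweigh the negative ones.\<close>
    have "0 \<le> c * (d - f)" "0 \<le> e * (c - f)" "0 \<le> d * (e - f)"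
      using assms by (auto intro!: mult_nonneg_nonneg)
    then show ?thesis by (simp add: algebra_simps power2_eq_square add_divide_distrib diff_divide_distrib)
  qed
  also have "\<dots> \<le> T\<^sup>2" using assms by (intro power_mono) (auto simp: T_def)
  finally have "a\<^sup>2 + b\<^sup>2 + c\<^sup>2 + d\<^sup>2 + e\<^sup>2 + f\<^sup>2 \<le> a\<^sup>2 + b\<^sup>2 + T\<^sup>2" by simp
  also have "\<dots> \<le> 12 / 5"
  proof -
    have "0 \<le> (1 - a) * (a - b)" "0 \<le> (1 - a) * (a + 3 * b - 24495/10000)" "0 \<le> (a - b) * (a + 3 * b - 24495/10000)"
      "0 \<le> (a + 3 * b - 24495/10000)\<^sup>2"
      using assms True by (auto intro!: mult_nonneg_nonneg)
    then show ?thesis using assms unfolding T_def by (simp add: algebra_simps power2_eq_square add_divide_distrib diff_divide_distrib)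
  qed
  finally show ?thesis .
next
  case False
  have "c\<^sup>2 \<le> b\<^sup>2" "d\<^sup>2 \<le> b\<^sup>2" "e\<^sup>2 \<le> b\<^sup>2" "f\<^sup>2 \<le> b\<^sup>2"
    using assms by (auto intro!: power_mono)
  moreover have "0 \<le> (1 - a) * (a - b)" "0 \<le> b * (24495/10000 - a - 3 * b)" "0 \<le> (a - b) * (24495/10000 - a - 3 * b)"
      "0 \<le> (24495/10000 - a - 3 * b)\<^sup>2"
    using assms False by (auto intro!: mult_nonneg_nonneg)
  ultimately show ?thesis using assms False by (simp add: algebra_simps power2_eq_square add_divide_distrib diff_divide_distrib)
qed

lemma w_6_le: "w TYPE(6) \<le> 44"
proof (rule w_le_of_parity[where K = "{1}" and L = "{}" and h = 0 and m = 6 and n = 6])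
  show "(\<Sum>k\<in>{1}. 2 ^ k * (6 choose k)) + (\<Sum>k\<in>{}. 2 ^ k * ((0 choose k) + ((6 - 0) choose k))) + 2 ^ (6 - 1) \<le> (44::nat)"
    by simp
  fix z :: "nat \<Rightarrow> real"
  assume dec: "\<And>i j. i \<le> j \<Longrightarrow> j < 6 \<Longrightarrow> z j \<le> z i" and nonneg: "\<And>i. 0 \<le> z i"
    and K: "\<And>k. k \<in> {1} \<Longrightarrow> (\<Sum>i<k. z i) \<le> sqrt k" and h: "(\<Sum>i<6. z i) - 2 * z (6 - 1) \<le> sqrt (6::nat)"
  have "z 0 \<le> 1" using K[of 1] by simp
  moreover have "z 0 + z 1 + z 2 + z 3 + z 4 - z 5 \<le> 24495/10000"
    using h sqrt_bounds(3) by (simp add: sum_numerals_unfold)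
  ultimately have "(z 0)\<^sup>2 + (z 1)\<^sup>2 + (z 2)\<^sup>2 + (z 3)\<^sup>2 + (z 4)\<^sup>2 + (z 5)\<^sup>2 \<le> 12 / 5"
    using dec nonneg by (intro axes_quadratic_dim6) auto
  then show "(\<Sum>i<6. (z i)\<^sup>2) \<le> 2 * real 6 / (real 6 - 1)" by (simp add: sum_numerals_unfold)
qed auto

section \<open>Dimension 7: the Fano plane\<close>

text \<open>
  The sequence \<open>(d, \<rho> - d, t)\<close> weakly majorizes \<open>(p1, p2, p3)\<close>; the proof is Abel summation against the differences of
  the partial sums.
\<close>

lemma majorized3:
  fixes d t \<rho> p1 p2 p3 :: real
  assumes "0 \<le> p3" "p3 \<le> p2" "p2 \<le> p1" "p1 \<le> d" "p1 + p2 \<le> \<rho>" "p1 + p2 + p3 \<le> \<rho> + t"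
    and "0 \<le> t" "t \<le> \<rho> - d" "\<rho> - d \<le> d"
  shows "p1\<^sup>2 + p2\<^sup>2 + p3\<^sup>2 \<le> d\<^sup>2 + (\<rho> - d)\<^sup>2 + t\<^sup>2"
proof -
  have "0 \<le> (d - p1) * ((d + p1) - ((\<rho> - d) + p2))"
    "0 \<le> (\<rho> - p1 - p2) * (((\<rho> - d) + p2) - (t + p3))"
    "0 \<le> (\<rho> + t - p1 - p2 - p3) * (t + p3)"
    using assms by (intro mult_nonneg_nonneg; simp)+
  then show ?thesis by (simp add: algebra_simps power2_eq_square)
qed

text \<open>
  As for three entries, with a fourth that the comparison sequence has equal to 0. Only \<open>q1\<close> is known to be the
  largest entry, so the other three are put in order first.
\<close>

lemma majorized4:
  fixes d t \<rho> q1 q2 q3 q4 :: real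
  assumes nonneg: "0 \<le> q2" "0 \<le> q3" "0 \<le> q4" and max: "q2 \<le> q1" "q3 \<le> q1" "q4 \<le> q1"
    and d: "q1 \<le> d" and pairs: "q1 + q2 \<le> \<rho>" "q1 + q3 \<le> \<rho>" "q1 + q4 \<le> \<rho>" and total: "q1 + q2 + q3 + q4 \<le> \<rho> + t"
    and t: "0 \<le> t" "t \<le> \<rho> - d" "\<rho> - d \<le> d"
  shows "q1\<^sup>2 + q2\<^sup>2 + q3\<^sup>2 + q4\<^sup>2 \<le> d\<^sup>2 + (\<rho> - d)\<^sup>2 + t\<^sup>2"
proof -
  have sorted: "q1\<^sup>2 + a\<^sup>2 + b\<^sup>2 + c\<^sup>2 \<le> d\<^sup>2 + (\<rho> - d)\<^sup>2 + t\<^sup>2"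
    if "0 \<le> c" "c \<le> b" "b \<le> a" "a \<le> q1" "q1 + a \<le> \<rho>" "q1 + a + b + c \<le> \<rho> + t" for a b c
  proof -
    have "0 \<le> (d - q1) * ((d + q1) - ((\<rho> - d) + a))"
      "0 \<le> (\<rho> - q1 - a) * (((\<rho> - d) + a) - (t + b))"
      "0 \<le> (\<rho> + t - q1 - a - b) * ((t + b) - c)"
      "0 \<le> (\<rho> + t - q1 - a - b - c) * c"
      using that t d by (intro mult_nonneg_nonneg; simp)+
    then show ?thesis by (simp add: algebra_simps power2_eq_square)
  qed
  consider "q4 \<le> q3" "q3 \<le> q2" | "q3 \<le> q4" "q4 \<le> q2" | "q4 \<le> q2" "q2 \<le> q3"
    | "q2 \<le> q4" "q4 \<le> q3" | "q3 \<le> q2" "q2 \<le> q4" | "q2 \<le> q3" "q3 \<le> q4"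
    by linarith
  then show ?thesis
  proof cases
    case 1 then show ?thesis using sorted[of q4 q3 q2] assms by simp
  next
    case 2 then show ?thesis using sorted[of q3 q4 q2] assms by simp
  next
    case 3 then show ?thesis using sorted[of q4 q2 q3] assms by simp
  next
    case 4 then show ?thesis using sorted[of q2 q4 q3] assms by simp
  next
    case 5 then show ?thesis using sorted[of q3 q2 q4] assms by simp
  next
    case 6 then show ?thesis using sorted[of q2 q3 q4] assms by simp
  qed
qed

text \<open>
  The entries \<open>p1, p2, p3\<close> belong to the points of a distinguished line. The other six lines each join one of these
  points to a pair of the remaining points \<open>q1, \<dots>, q4\<close>; the two lines through \<open>p\<^sub>i\<close> give a perfect matching of the
  four points, and the three matchings are the ones of the complete graph on them. Pairs are constrained only
  within the line and within its complement.
\<close>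

definition fano_constraints :: "real \<Rightarrow> real \<Rightarrow> real \<Rightarrow> real \<Rightarrow> real \<Rightarrow> real \<Rightarrow> real \<Rightarrow> bool" where
  "fano_constraints p1 p2 p3 q1 q2 q3 q4 \<longleftrightarrow>
    0 \<le> p1 \<and> 0 \<le> p2 \<and> 0 \<le> p3 \<and> 0 \<le> q1 \<and> 0 \<le> q2 \<and> 0 \<le> q3 \<and> 0 \<le> q4 \<and>
    p1 \<le> 1 \<and> p2 \<le> 1 \<and> p3 \<le> 1 \<and> q1 \<le> 1 \<and> q2 \<le> 1 \<and> q3 \<le> 1 \<and> q4 \<le> 1 \<and>
    p1 + p2 \<le> 14143/10000 \<and> p1 + p3 \<le> 14143/10000 \<and> p2 + p3 \<le> 14143/10000 \<and>
    q1 + q2 \<le> 14143/10000 \<and> q1 + q3 \<le> 14143/10000 \<and> q1 + q4 \<le> 14143/10000 \<and>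
    q2 + q3 \<le> 14143/10000 \<and> q2 + q4 \<le> 14143/10000 \<and> q3 + q4 \<le> 14143/10000 \<and>
    p1 + p2 + p3 \<le> sqrt 3 \<and>
    p1 + q1 + q2 \<le> sqrt 3 \<and> p1 + q3 + q4 \<le> sqrt 3 \<and>
    p2 + q1 + q3 \<le> sqrt 3 \<and> p2 + q2 + q4 \<le> sqrt 3 \<and>
    p3 + q1 + q4 \<le> sqrt 3 \<and> p3 + q2 + q3 \<le> sqrt 3"

lemma fano_constraintsD:
  assumes "fano_constraints p1 p2 p3 q1 q2 q3 q4"
  shows "0 \<le> p1" "0 \<le> p2" "0 \<le> p3" "0 \<le> q1" "0 \<le> q2" "0 \<le> q3"
    "0 \<le> q4" "p1 \<le> 1" "p2 \<le> 1" "p3 \<le> 1" "q1 \<le> 1" "q2 \<le> 1"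
    "q3 \<le> 1" "q4 \<le> 1" "p1 + p2 \<le> 14143/10000" "p1 + p3 \<le> 14143/10000" "p2 + p3 \<le> 14143/10000" "q1 + q2 \<le> 14143/10000"
    "q1 + q3 \<le> 14143/10000" "q1 + q4 \<le> 14143/10000" "q2 + q3 \<le> 14143/10000" "q2 + q4 \<le> 14143/10000" "q3 + q4 \<le> 14143/10000" "p1 + p2 + p3 \<le> sqrt 3"
    "p1 + q1 + q2 \<le> sqrt 3" "p1 + q3 + q4 \<le> sqrt 3" "p2 + q1 + q3 \<le> sqrt 3" "p2 + q2 + q4 \<le> sqrt 3" "p3 + q1 + q4 \<le> sqrt 3" "p3 + q2 + q3 \<le> sqrt 3"
  using assms unfolding fano_constraints_def by blast+

text \<open>
  Collineations fixing the distinguished line: these four generate all permutations of its points, and they move any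
  of the remaining points to the place of \<open>q1\<close>.
\<close>

lemma fano_swap12: "fano_constraints p1 p2 p3 q1 q2 q3 q4 \<Longrightarrow> fano_constraints p2 p1 p3 q1 q3 q2 q4"
  unfolding fano_constraints_def by (simp add: add.commute add.left_commute)

lemma fano_swap23: "fano_constraints p1 p2 p3 q1 q2 q3 q4 \<Longrightarrow> fano_constraints p1 p3 p2 q1 q2 q4 q3"
  unfolding fano_constraints_def by (simp add: add.commute add.left_commute)

lemma fano_shift12: "fano_constraints p1 p2 p3 q1 q2 q3 q4 \<Longrightarrow> fano_constraints p1 p2 p3 q2 q1 q4 q3"
  unfolding fano_constraints_def by (simp add: add.commute add.left_commute)

lemma fano_shift13: "fano_constraints p1 p2 p3 q1 q2 q3 q4 \<Longrightarrow> fano_constraints p1 p2 p3 q3 q4 q1 q2"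
  unfolding fano_constraints_def by (simp add: add.commute add.left_commute)

lemma sqrt_3_facts: "sqrt 3 * sqrt 3 = 3" "1732/1000 \<le> sqrt 3" "sqrt 3 \<le> 17321/10000"
proof -
  show "1732/1000 \<le> sqrt 3" by (rule real_le_rsqrt) (simp add: power2_eq_square)
  show "sqrt 3 \<le> 17321/10000" by (rule sqrt_bounds)
qed simp

text \<open>
  Each \<open>p\<^sub>i\<close> is at most \<open>sqrt 3\<close> minus the sum of either pair in its matching, so its square is at most the
  product of the two differences. Over the three matchings, the products \<open>q\<^sub>i * q\<^sub>j\<close> add up so that only
  \<open>q1 + q2 + q3 + q4\<close> remains, and the resulting quadratic polynomial takes the value \<open>7 / 3\<close> at the lower end of
  the range of this sum. Equality holds when all seven entries are \<open>sqrt 3 / 3\<close>.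
\<close>

lemma fano_large:
  assumes "fano_constraints p1 p2 p3 q1 q2 q3 q4" and s: "4 * sqrt 3 / 3 \<le> q1 + q2 + q3 + q4"
  shows "p1\<^sup>2 + p2\<^sup>2 + p3\<^sup>2 + q1\<^sup>2 + q2\<^sup>2 + q3\<^sup>2 + q4\<^sup>2 \<le> 7 / 3"
proof -
  note c = fano_constraintsD[OF assms(1)]
  define r where "r = sqrt 3"
  have r: "r * r = 3" "1732/1000 \<le> r" using sqrt_3_facts by (simp_all add: r_def)
  have "p1 * p1 \<le> (r - q1 - q2) * (r - q3 - q4)" "p2 * p2 \<le> (r - q1 - q3) * (r - q2 - q4)"
    "p3 * p3 \<le> (r - q1 - q4) * (r - q2 - q3)"
    unfolding r_def by (rule mult_mono; use c(1-7,25-30) in linarith)+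
  then have "p1\<^sup>2 + p2\<^sup>2 + p3\<^sup>2 + q1\<^sup>2 + q2\<^sup>2 + q3\<^sup>2 + q4\<^sup>2
      \<le> (q1 + q2 + q3 + q4)\<^sup>2 - 3 * r * (q1 + q2 + q3 + q4) + 3 * (r * r)"
    by (simp add: algebra_simps power2_eq_square)
  also have "\<dots> = 7 / 3 + (q1 + q2 + q3 + q4 - 4 * r / 3) * (q1 + q2 + q3 + q4 - 5 * r / 3)"
  proof -
    have "(t - 4 * r / 3) * (t - 5 * r / 3) = t\<^sup>2 - 3 * r * t + 20 / 9 * (r * r)" for t
      by (simp add: field_simps power2_eq_square)
    then show ?thesis by (simp add: r(1))
  qed
  also have "\<dots> \<le> 7 / 3"
  proof -
    have "q1 + q2 + q3 + q4 - 5 * r / 3 \<le> 0" "0 \<le> q1 + q2 + q3 + q4 - 4 * r / 3"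
      using c(18,23) r(2) s unfolding r_def by linarith+
    then show ?thesis by (simp add: mult_nonneg_nonpos)
  qed
  finally show ?thesis .
qed

text \<open>
  In an orthogonal basis of \<open>\<real>\<^sup>4\<close> made of the constant vector and the three matchings, the squares of the \<open>q\<^sub>i\<close>
  are the square of half their sum \<open>s\<close> and of the half differences \<open>\<delta>\<^sub>i\<close> of the two pair sums in a matching. The
  two lines through \<open>p\<^sub>i\<close> say \<open>p\<^sub>i + \<bar>\<delta>\<^sub>i\<bar> \<le> y\<close> with \<open>y = sqrt 3 - s / 2\<close>. So it remains to maximize the convex
  function \<open>\<Sum>p\<^sub>i\<^sup>2 + (y - p\<^sub>i)\<^sup>2\<close> under the constraints on the line \<open>p1, p2, p3\<close>.
\<close>

lemma fano_medium:
  assumes c: "fano_constraints p1 p2 p3 q1 q2 q3 q4" and p: "p3 \<le> p2" "p2 \<le> p1" "sqrt 3 - 14143/10000 \<le> p3"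
    and s: "sqrt 3 \<le> q1 + q2 + q3 + q4" "q1 + q2 + q3 + q4 \<le> 4 * sqrt 3 / 3"
  shows "p1\<^sup>2 + p2\<^sup>2 + p3\<^sup>2 + q1\<^sup>2 + q2\<^sup>2 + q3\<^sup>2 + q4\<^sup>2 \<le> 7 / 3"
proof -
  note c = fano_constraintsD[OF c]
  \<comment> \<open>\<open>y\<close> bounds the sum of \<open>p\<^sub>i\<close> and the half difference of its matching; \<open>\<rho>\<close> is the bound for pairs.\<close>
  define r y \<rho> :: real where "r = sqrt 3" and "y = r - (q1 + q2 + q3 + q4) / 2" and "\<rho> = 14143/10000"
  have r: "r * r = 3" "1732/1000 \<le> r" "r \<le> 17321/10000" using sqrt_3_facts by (simp_all add: r_def)
  have y: "r / 3 \<le> y" "y \<le> r / 2" using s by (simp_all add: y_def r_def)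
  have sq: "((a - b) / 2)\<^sup>2 \<le> (y - p)\<^sup>2" and py: "p \<le> y"
    if "a + b = q1 + q2 + q3 + q4" "p + a \<le> r" "p + b \<le> r" for a b p
  proof -
    have "\<bar>(a - b) / 2\<bar> \<le> y - p" using that unfolding y_def by (simp add: abs_if field_simps)
    then show "((a - b) / 2)\<^sup>2 \<le> (y - p)\<^sup>2" "p \<le> y" by (simp_all add: abs_le_square_iff[symmetric])
  qed
  have py': "p1 \<le> y" using py[of "q1 + q2" "q3 + q4" p1] c(25,26) by (simp add: r_def add.assoc)
  have "((q1 + q2 - (q3 + q4)) / 2)\<^sup>2 \<le> (y - p1)\<^sup>2" "((q1 + q3 - (q2 + q4)) / 2)\<^sup>2 \<le> (y - p2)\<^sup>2"
    "((q1 + q4 - (q2 + q3)) / 2)\<^sup>2 \<le> (y - p3)\<^sup>2"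
    unfolding r_def by (rule sq[unfolded r_def]; use c(25-30) in linarith)+
  moreover have "q1\<^sup>2 + q2\<^sup>2 + q3\<^sup>2 + q4\<^sup>2 = ((q1 + q2 + q3 + q4) / 2)\<^sup>2 + ((q1 + q2 - (q3 + q4)) / 2)\<^sup>2
      + ((q1 + q3 - (q2 + q4)) / 2)\<^sup>2 + ((q1 + q4 - (q2 + q3)) / 2)\<^sup>2"
    by (simp add: algebra_simps power2_eq_square add_divide_distrib diff_divide_distrib)
  moreover have "(q1 + q2 + q3 + q4) / 2 = r - y" by (simp add: y_def)
  ultimately have main: "p1\<^sup>2 + p2\<^sup>2 + p3\<^sup>2 + q1\<^sup>2 + q2\<^sup>2 + q3\<^sup>2 + q4\<^sup>2
      \<le> (r - y)\<^sup>2 + (p1\<^sup>2 + (y - p1)\<^sup>2) + (p2\<^sup>2 + (y - p2)\<^sup>2) + (p3\<^sup>2 + (y - p3)\<^sup>2)"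
    by simp
  show ?thesis
  proof (cases "y \<le> 76/100")
    case True
    \<comment> \<open>All \<open>p\<^sub>i\<close> lie in \<open>[r - \<rho>, y]\<close>, and the chord over this interval is linear in \<open>p1 + p2 + p3\<close>.\<close>
    have chord: "p\<^sup>2 + (y - p)\<^sup>2 \<le> 2 * (r - \<rho>) * p - 2 * (r - \<rho>) * y + y\<^sup>2" if "r - \<rho> \<le> p" "p \<le> y" for p
    proof -
      have "0 \<le> (p - (r - \<rho>)) * (y - p)" using that by simp
      then show ?thesis by (simp add: algebra_simps power2_eq_square)
    qed
    have "p1\<^sup>2 + p2\<^sup>2 + p3\<^sup>2 + q1\<^sup>2 + q2\<^sup>2 + q3\<^sup>2 + q4\<^sup>2
        \<le> (r - y)\<^sup>2 + 2 * (r - \<rho>) * (p1 + p2 + p3) - 6 * (r - \<rho>) * y + 3 * y\<^sup>2"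
      using main chord[of p1] chord[of p2] chord[of p3] p py'
      by (simp add: algebra_simps r_def \<rho>_def add_divide_distrib diff_divide_distrib)
    also have "\<dots> \<le> (r - y)\<^sup>2 + 2 * (r - \<rho>) * r - 6 * (r - \<rho>) * y + 3 * y\<^sup>2"
      using c(24) r(2) by (intro add_right_mono diff_right_mono add_left_mono mult_left_mono) (simp_all add: r_def \<rho>_def)
    also have "\<dots> = 7 / 3 - (y - r / 3) * (20 / 3 * r - 6 * \<rho> - 4 * (76/100)) - 4 * (y - r / 3) * (76/100 - y)"
      using r(1) by (simp add: algebra_simps power2_eq_square add_divide_distrib diff_divide_distrib)
    also have "\<dots> \<le> 7 / 3"
    proof -
      have "0 \<le> (y - r / 3) * (20 / 3 * r - 6 * \<rho> - 4 * (76/100))" "0 \<le> 4 * (y - r / 3) * (76/100 - y)"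
        using y True r by (auto intro!: mult_nonneg_nonneg simp: \<rho>_def)
      then show ?thesis by linarith
    qed
    finally show ?thesis .
  next
    case False
    define \<mu> where "\<mu> = \<rho> - y"
    \<comment> \<open>Under \<open>p1 + p2 \<le> \<rho>\<close> the extreme pair is \<open>(y, \<mu>)\<close>, and \<open>p3 \<le> r / 3\<close> is extreme at \<open>r / 3\<close>.\<close>
    have p12: "(p1\<^sup>2 + (y - p1)\<^sup>2) + (p2\<^sup>2 + (y - p2)\<^sup>2) \<le> y\<^sup>2 + (\<mu>\<^sup>2 + (y - \<mu>)\<^sup>2)"
    proof (cases "\<mu> \<le> p2")
      case True
      have \<mu>0: "0 \<le> \<mu>" using y r by (simp add: \<mu>_def \<rho>_def)
      have "0 \<le> (p1 - \<mu>) * (y - p1)" "0 \<le> (p2 - \<mu>) * (y - p2)" "0 \<le> \<mu> * (y + \<mu> - p1 - p2)"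
        using True p(1,2) py' c(15) \<mu>0 by (intro mult_nonneg_nonneg; simp add: \<mu>_def \<rho>_def)+
      then show ?thesis by (simp add: algebra_simps power2_eq_square)
    next
      case False
      have "0 \<le> p1 * (y - p1)" "0 \<le> (\<mu> - p2) * (p2 + \<mu> - y)"
        using False p py' c(1) y by (intro mult_nonneg_nonneg; simp add: \<mu>_def \<rho>_def r_def)+
      then show ?thesis by (simp add: algebra_simps power2_eq_square)
    qed
    have "0 \<le> (r / 3 - p3) * (p3 + r / 3 - y)"
      using p y c(24) r(2,3) by (intro mult_nonneg_nonneg; simp add: r_def)
    then have "p3\<^sup>2 + (y - p3)\<^sup>2 \<le> (r / 3)\<^sup>2 + (y - r / 3)\<^sup>2"
      by (simp add: algebra_simps power2_eq_square)
    then have "p1\<^sup>2 + p2\<^sup>2 + p3\<^sup>2 + q1\<^sup>2 + q2\<^sup>2 + q3\<^sup>2 + q4\<^sup>2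
      \<le> (r - y)\<^sup>2 + y\<^sup>2 + (\<mu>\<^sup>2 + (y - \<mu>)\<^sup>2) + ((r / 3)\<^sup>2 + (y - r / 3)\<^sup>2)"
      using main p12 by linarith
    also have "\<dots> \<le> (17321/10000 - y)\<^sup>2 + y\<^sup>2 + (\<mu>\<^sup>2 + (y - \<mu>)\<^sup>2) + ((57737/100000)\<^sup>2 + (y - 57733/100000)\<^sup>2)"
      using r y False by (intro add_mono order_refl power_mono) auto
    also have "\<dots> \<le> 7 / 3"
    proof -
      have "0 \<le> (y - 76/100) * (86605/100000 - y)" using False y r by (intro mult_nonneg_nonneg) auto
      then show ?thesis using False y r unfolding \<mu>_def \<rho>_def
        by (simp add: algebra_simps power2_eq_square add_divide_distrib diff_divide_distrib)
    qed
    finally show ?thesis .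
  qed
qed

text \<open>
  The left side is a convex function of \<open>d\<close>, bounded here by its chord.
\<close>

lemma fano_small_bound:
  fixes d :: real
  assumes "7321/10000 \<le> d" "d \<le> 86605/100000"
  shows "(17321/10000 - d)\<^sup>2 + (d - 3178/10000)\<^sup>2 + d\<^sup>2 + (14143/10000 - d)\<^sup>2 + (3178/10000)\<^sup>2 + (2 * d - 14143/10000)\<^sup>2 \<le> 7 / 3"
proof -
  have "0 \<le> (d - 7321/10000) * (86605/100000 - d)" using assms by simp
  then show ?thesis using assms by (simp add: algebra_simps power2_eq_square add_divide_distrib diff_divide_distrib)
qed

text \<open>
  When \<open>q1 + q2 + q3 + q4 \<le> sqrt 3\<close>, both groups have sum at most \<open>sqrt 3\<close> and pair sums at most \<open>sqrt 2\<close>, so each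
  is majorized by an explicit sequence that depends on a bound for its largest entry. The lines couple the groups:
  if one contains an entry \<open>g \<ge> sqrt 3 / 2\<close>, then the entries of the other are at most \<open>d = sqrt 3 - g\<close>, and the
  sum of these is limited as well.
\<close>

lemma fano_small:
  assumes c: "fano_constraints p1 p2 p3 q1 q2 q3 q4" and p: "p3 \<le> p2" "p2 \<le> p1"
    and q: "q2 \<le> q1" "q3 \<le> q1" "q4 \<le> q1" and s: "q1 + q2 + q3 + q4 \<le> sqrt 3"
  shows "p1\<^sup>2 + p2\<^sup>2 + p3\<^sup>2 + q1\<^sup>2 + q2\<^sup>2 + q3\<^sup>2 + q4\<^sup>2 \<le> 7 / 3"
proof -
  note c = fano_constraintsD[OF c]
  define r \<rho> \<tau> :: real where "r = 17321/10000" and "\<rho> = 14143/10000" and "\<tau> = 3178/10000"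
  have r: "sqrt 3 \<le> r" unfolding r_def by (rule sqrt_bounds)
  have \<tau>: "\<rho> + \<tau> = r" by (simp add: r_def \<rho>_def \<tau>_def)
  have P: "p1 + p2 + p3 \<le> \<rho> + \<tau>" and Q: "q1 + q2 + q3 + q4 \<le> \<rho> + \<tau>"
    using c(24) r s \<tau> by linarith+
  \<comment> \<open>The common final estimate of the two cases with a large entry \<open>r - d\<close>.\<close>
  have bound: "(r - d)\<^sup>2 + (d - \<tau>)\<^sup>2 + d\<^sup>2 + (\<rho> - d)\<^sup>2 + \<tau>\<^sup>2 + (2 * d - \<rho>)\<^sup>2 \<le> 7 / 3" if "r - 1 \<le> d" "d \<le> r / 2" for d
    using fano_small_bound[of d] that unfolding r_def \<rho>_def \<tau>_def by simp
  consider (flat) "p1 \<le> r / 2" "q1 \<le> r / 2" | (p) "r / 2 \<le> p1" | (q) "r / 2 \<le> q1" by linarith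
  then show ?thesis
  proof cases
    case flat
    define K where "K = (r/2)\<^sup>2 + (\<rho> - r/2)\<^sup>2 + \<tau>\<^sup>2"
    have "p1\<^sup>2 + p2\<^sup>2 + p3\<^sup>2 \<le> K"
      unfolding K_def using flat c(3,15) p P by (intro majorized3) (simp_all add: r_def \<rho>_def \<tau>_def)
    moreover have "q1\<^sup>2 + q2\<^sup>2 + q3\<^sup>2 + q4\<^sup>2 \<le> K"
      unfolding K_def using flat c(5-7,18-20) q Q by (intro majorized4) (simp_all add: r_def \<rho>_def \<tau>_def)
    moreover have "2 * K \<le> 7 / 3"
      by (simp add: K_def r_def \<rho>_def \<tau>_def power2_eq_square)
    ultimately show ?thesis by linarith
  next
    case p
    define d where "d = r - p1"
    have d: "r - 1 \<le> d" "d \<le> r / 2" using p c(8) by (simp_all add: d_def)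
    have "p1\<^sup>2 + p2\<^sup>2 + p3\<^sup>2 \<le> p1\<^sup>2 + (\<rho> - p1)\<^sup>2 + \<tau>\<^sup>2"
      using p c(3,8,15) assms(2,3) P by (intro majorized3) (simp_all add: r_def \<rho>_def \<tau>_def)
    moreover have "q1\<^sup>2 + q2\<^sup>2 + q3\<^sup>2 + q4\<^sup>2 \<le> d\<^sup>2 + (\<rho> - d)\<^sup>2 + (2 * d - \<rho>)\<^sup>2"
      using d c(5-7,18-20,25,26) q r by (intro majorized4) (simp_all add: d_def r_def \<rho>_def)
    moreover have "p1\<^sup>2 + (\<rho> - p1)\<^sup>2 = (r - d)\<^sup>2 + (d - \<tau>)\<^sup>2"
    proof -
      have e: "\<rho> - p1 = d - \<tau>" "p1 = r - d" using \<tau> by (simp_all add: d_def)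
      show ?thesis unfolding e(1) by (simp only: e(2))
    qed
    ultimately show ?thesis using bound[OF d] by linarith
  next
    case q
    \<comment> \<open>\<open>v\<close> and \<open>t\<close> are the smallest entries of the two majorizing sequences. The three lines through \<open>q1\<close>
      bound \<open>p1 + p2 + p3\<close> by \<open>3 * d - (q2 + q3 + q4)\<close>, so \<open>t\<close> and \<open>v\<close> cannot both be large.\<close>
    define d e v t where "d = r - q1" and "e = \<rho> - q1" and "v = max 0 (q2 + q3 + q4 - e)"
      and "t = min \<tau> (3 * d - (q2 + q3 + q4) - \<rho>)"
    have d: "r - 1 \<le> d" "d \<le> r / 2" using q c(11) by (simp_all add: d_def)
    have de: "e = d - \<tau>" using \<tau> by (simp add: d_def e_def)
    have rest: "q2 + q3 + q4 \<le> d" using Q \<tau> by (simp add: d_def)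
    have v: "0 \<le> v" "v \<le> \<tau>" using rest de unfolding v_def by (auto simp: \<tau>_def max_def)
    have t: "0 \<le> t" "t \<le> \<tau>" using rest d by (auto simp: t_def \<tau>_def \<rho>_def r_def min_def)
    have "q1\<^sup>2 + q2\<^sup>2 + q3\<^sup>2 + q4\<^sup>2 \<le> q1\<^sup>2 + (\<rho> - q1)\<^sup>2 + v\<^sup>2"
    proof (rule majorized4)
      show "q1 + q2 + q3 + q4 \<le> \<rho> + v" by (simp add: v_def e_def)
    qed (use q c(5-7,11,18-20) assms(4-6) v in \<open>simp_all add: r_def \<rho>_def \<tau>_def\<close>)
    moreover have "p1\<^sup>2 + p2\<^sup>2 + p3\<^sup>2 \<le> d\<^sup>2 + (\<rho> - d)\<^sup>2 + t\<^sup>2"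
    proof (rule majorized3)
      show "p1 \<le> d" using c(5,25) r by (simp add: d_def)
      have "p1 + p2 + p3 \<le> 3 * d - (q2 + q3 + q4)" using c(25,27,29) r by (simp add: d_def)
      then show "p1 + p2 + p3 \<le> \<rho> + t" using P by (simp add: t_def)
    qed (use c(3,15) assms(2,3) t d in \<open>simp_all add: r_def \<rho>_def \<tau>_def\<close>)
    moreover have "t\<^sup>2 + v\<^sup>2 \<le> \<tau>\<^sup>2 + (2 * d - \<rho>)\<^sup>2"
    proof (cases "t + v \<le> \<tau>")
      case True
      have "t\<^sup>2 + v\<^sup>2 \<le> (t + v)\<^sup>2" using t v by (simp add: power2_sum)
      also have "\<dots> \<le> \<tau>\<^sup>2" using True t v by (intro power_mono) auto
      finally show ?thesis by (simp add: add_increasing2)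
    next
      case False
      then have "v = q2 + q3 + q4 - e" using t by (auto simp: v_def max_def split: if_splits)
      then have tv: "t + v - \<tau> \<le> 2 * d - \<rho>" using de by (auto simp: t_def)
      have "0 \<le> (\<tau> - t) * (\<tau> - v)" using t v by simp
      then have "t\<^sup>2 + v\<^sup>2 \<le> \<tau>\<^sup>2 + (t + v - \<tau>)\<^sup>2" by (simp add: algebra_simps power2_eq_square)
      also have "\<dots> \<le> \<tau>\<^sup>2 + (2 * d - \<rho>)\<^sup>2" using tv False by (intro add_left_mono power_mono) auto
      finally show ?thesis .
    qed
    moreover have "q1\<^sup>2 + (\<rho> - q1)\<^sup>2 = (r - d)\<^sup>2 + (d - \<tau>)\<^sup>2"
    proof -
      have e: "\<rho> - q1 = d - \<tau>" "q1 = r - d" using de by (simp_all add: d_def e_def)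
      show ?thesis unfolding e(1) by (simp only: e(2))
    qed
    ultimately show ?thesis using bound[OF d] by linarith
  qed
qed

text \<open>
  For a sum of the \<open>q\<^sub>i\<close> in the middle range, the entries \<open>p\<^sub>i\<close> may be raised to \<open>\<tau> = sqrt 3 - sqrt 2\<close>: a line
  through a raised point still has sum at most \<open>sqrt 3\<close>, because its other two points form a constrained pair. If
  more than one point of the distinguished line is raised, its sum is at most \<open>1 + 2 * \<tau>\<close>.
\<close>

lemma fano_sorted:
  assumes c: "fano_constraints p1 p2 p3 q1 q2 q3 q4" and p: "p3 \<le> p2" "p2 \<le> p1"
    and q: "q2 \<le> q1" "q3 \<le> q1" "q4 \<le> q1"
  shows "p1\<^sup>2 + p2\<^sup>2 + p3\<^sup>2 + q1\<^sup>2 + q2\<^sup>2 + q3\<^sup>2 + q4\<^sup>2 \<le> 7 / 3"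
proof -
  define \<tau> where "\<tau> = sqrt 3 - 14143/10000"
  consider "q1 + q2 + q3 + q4 \<le> sqrt 3" | "4 * sqrt 3 / 3 \<le> q1 + q2 + q3 + q4"
    | "sqrt 3 \<le> q1 + q2 + q3 + q4" "q1 + q2 + q3 + q4 \<le> 4 * sqrt 3 / 3" by linarith
  then show ?thesis
  proof cases
    case 1 then show ?thesis using fano_small[OF c p q] by simp
  next
    case 2 then show ?thesis using fano_large[OF c] by simp
  next
    case 3
    have \<tau>: "0 \<le> \<tau>" "\<tau> \<le> 3178/10000" "\<tau> + 14143/10000 = sqrt 3" using sqrt_3_facts by (auto simp: \<tau>_def)
    note c' = fano_constraintsD[OF c]
    have m0: "0 \<le> max x \<tau>" for x using \<tau>(1) by simp
    have m1: "max x \<tau> \<le> 1" if "x \<le> 1" for x using that \<tau>(2) by simp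
    have m2: "max x \<tau> + max y \<tau> \<le> 14143/10000" if "x + y \<le> 14143/10000" "x \<le> 1" "y \<le> 1" for x y
      using that \<tau>(2) by (simp add: max_def)
    have m3: "max x \<tau> + a + b \<le> sqrt 3" if "x + a + b \<le> sqrt 3" "a + b \<le> 14143/10000" for x a b
      using that \<tau>(3) by (simp add: max_def)
    have m: "max p1 \<tau> + max p2 \<tau> + max p3 \<tau> \<le> sqrt 3"
      using c'(8,15,24) p \<tau>(2,3) sqrt_3_facts(2) by (simp add: max_def)
    \<comment> \<open>Each constraint is either unaffected by the raising or an instance of one of the facts above.\<close>
    have "fano_constraints (max p1 \<tau>) (max p2 \<tau>) (max p3 \<tau>) q1 q2 q3 q4"
      unfolding fano_constraints_def
      by (intro conjI; (rule c' m m0 | (rule m1 m2 m3; rule c')))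
    then have "(max p1 \<tau>)\<^sup>2 + (max p2 \<tau>)\<^sup>2 + (max p3 \<tau>)\<^sup>2 + q1\<^sup>2 + q2\<^sup>2 + q3\<^sup>2 + q4\<^sup>2 \<le> 7 / 3"
      using 3 p by (intro fano_medium) (auto simp: \<tau>_def)
    moreover have "p1\<^sup>2 \<le> (max p1 \<tau>)\<^sup>2" "p2\<^sup>2 \<le> (max p2 \<tau>)\<^sup>2" "p3\<^sup>2 \<le> (max p3 \<tau>)\<^sup>2"
      using c'(1-3) by (simp_all add: power_mono)
    ultimately show ?thesis by linarith
  qed
qed

lemma fano_quadratic:
  assumes c: "fano_constraints p1 p2 p3 q1 q2 q3 q4"
  shows "p1\<^sup>2 + p2\<^sup>2 + p3\<^sup>2 + q1\<^sup>2 + q2\<^sup>2 + q3\<^sup>2 + q4\<^sup>2 \<le> 7 / 3"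
proof -
  have qmax: "p1\<^sup>2 + p2\<^sup>2 + p3\<^sup>2 + a\<^sup>2 + b\<^sup>2 + c\<^sup>2 + d\<^sup>2 \<le> 7 / 3"
    if "fano_constraints p1 p2 p3 a b c d" "b \<le> a" "c \<le> a" "d \<le> a" for a b c d
  proof -
    note s12 = fano_swap12 and s23 = fano_swap23
    consider "p3 \<le> p2" "p2 \<le> p1" | "p3 \<le> p1" "p1 \<le> p2" | "p2 \<le> p3" "p3 \<le> p1"
      | "p1 \<le> p3" "p3 \<le> p2" | "p2 \<le> p1" "p1 \<le> p3" | "p1 \<le> p2" "p2 \<le> p3" by linarith
    then show ?thesis
    proof cases
      case 1 then show ?thesis using fano_sorted[OF that(1)] that by simp
    next
      case 2 then show ?thesis using fano_sorted[OF s12[OF that(1)]] that by simp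
    next
      case 3 then show ?thesis using fano_sorted[OF s23[OF that(1)]] that by simp
    next
      case 4 then show ?thesis using fano_sorted[OF s23[OF s12[OF that(1)]]] that by simp
    next
      case 5 then show ?thesis using fano_sorted[OF s12[OF s23[OF that(1)]]] that by simp
    next
      case 6 then show ?thesis using fano_sorted[OF s12[OF s23[OF s12[OF that(1)]]]] that by simp
    qed
  qed
  consider "q2 \<le> q1" "q3 \<le> q1" "q4 \<le> q1" | "q1 \<le> q2" "q3 \<le> q2" "q4 \<le> q2"
    | "q1 \<le> q3" "q2 \<le> q3" "q4 \<le> q3" | "q1 \<le> q4" "q2 \<le> q4" "q3 \<le> q4" by linarith
  then show ?thesis
  proof cases
    case 1 then show ?thesis using qmax[OF c] by simp
  next
    case 2 then show ?thesis using qmax[OF fano_shift12[OF c]] by simp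
  next
    case 3 then show ?thesis using qmax[OF fano_shift13[OF c]] by simp
  next
    case 4 then show ?thesis using qmax[OF fano_shift13[OF fano_shift12[OF c]]] by simp
  qed
qed

definition fano_supports :: "nat list list" where
  "fano_supports = [[0], [1], [2], [3], [4], [5], [6],
    [0,1], [0,2], [1,2], [3,4], [3,5], [3,6], [4,5], [4,6], [5,6],
    [0,1,2], [0,3,4], [0,5,6], [1,3,5], [1,4,6], [2,3,6], [2,4,5]]"

lemma w_7_le: "w TYPE(7) \<le> 112"
proof (rule w_le_of_sets[where n = 7 and F = "set ` set fano_supports" and C = "{}"])
  have "\<forall>xs\<in>set fano_supports. xs \<noteq> [] \<and> (\<forall>i\<in>set xs. i < 7)"
    by (simp add: fano_supports_def)
  then show "S \<subseteq> {..<7} \<and> S \<noteq> {}" if "S \<in> set ` set fano_supports" for S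
    using that by fastforce
  have "(\<Sum>S\<in>set ` set fano_supports. 2 ^ card S) \<le> (\<Sum>xs\<in>set fano_supports. (2::nat) ^ card (set xs))"
    using sum_image_le[of "set fano_supports" "\<lambda>S. (2::nat) ^ card S" set] by (simp add: o_def)
  also have "\<dots> \<le> (\<Sum>xs\<leftarrow>fano_supports. 2 ^ card (set xs))" by (rule sum_set_le_sum_list)
  also have "\<dots> = 106" by (simp add: fano_supports_def)
  finally show "(\<Sum>S\<in>set ` set fano_supports. 2 ^ card S) + card ({} :: nat set set) \<le> 112" by simp
  fix a :: "nat \<Rightarrow> real" and Z
  assume a: "\<And>i. 0 \<le> a i" and F: "\<And>S. S \<in> set ` set fano_supports \<Longrightarrow> (\<Sum>i\<in>S. a i) \<le> sqrt (card S)"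
  have f: "(\<Sum>i\<in>set xs. a i) \<le> sqrt (card (set xs))" if "xs \<in> set fano_supports" for xs using F that by blast
  have one: "a i \<le> 1" if "[i] \<in> set fano_supports" for i using f[OF that] by simp
  have two: "a i + a j \<le> 14143/10000" if "[i,j] \<in> set fano_supports" "i \<noteq> j" for i j
    using f[OF that(1)] that(2) sqrt_bounds(1) by simp
  have three: "a i + a j + a k \<le> sqrt 3" if "[i,j,k] \<in> set fano_supports" "i \<noteq> j" "i \<noteq> k" "j \<noteq> k" for i j k
    using f[OF that(1)] that(2-4) by (simp add: add.assoc)
  have "fano_constraints (a 0) (a 1) (a 2) (a 3) (a 4) (a 5) (a 6)"
    unfolding fano_constraints_def
    by (intro conjI a one two three; simp add: fano_supports_def)
  from fano_quadratic[OF this] show "(\<Sum>i<7. (a i)\<^sup>2) \<le> 2 * real 7 / (real 7 - 1)"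
    by (simp add: sum_numerals_unfold)
qed auto

section \<open>Dimensions 8 to 10: pairs\<close>

text \<open>
  Here \<open>a\<close> and \<open>u\<close> are the two largest entries, \<open>m\<close> is the lost one, and \<open>h - a - u\<close> is the signed sum of the
  tail. For fixed \<open>u\<close> and \<open>m\<close> the left side grows until \<open>a\<close> reaches \<open>r - u\<close>, and then the dependence on \<open>m\<close> is
  convex, so that only \<open>u\<close> remains.
\<close>

lemma pairs_quadratic:
  fixes a u m h r :: real
  assumes m: "0 \<le> m" "m \<le> u" and a: "u \<le> a" "a + u \<le> r"
  shows "a\<^sup>2 + u\<^sup>2 + (u * (h - a - u) + m * (h - a - u + 2 * m - q * u))
    \<le> r\<^sup>2 + (h - 3 * r) * u + 2 * u\<^sup>2 + max 0 (u * (h - r + 2 * u - q * u))"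
proof -
  \<comment> \<open>The second factor is nonnegative since \<open>u \<le> a\<close> and \<open>u + m \<le> 2 * u \<le> r\<close>.\<close>
  have "0 \<le> (r - u - a) * (r + a - 2 * u - m)" using assms by (intro mult_nonneg_nonneg) auto
  then have "a\<^sup>2 + u\<^sup>2 + (u * (h - a - u) + m * (h - a - u + 2 * m - q * u))
    \<le> r\<^sup>2 + (h - 3 * r) * u + 2 * u\<^sup>2 + m * (h - r - q * u + 2 * m)"
    by (simp add: algebra_simps power2_eq_square)
  also have "m * (h - r - q * u + 2 * m) \<le> max 0 (u * (h - r - q * u + 2 * u))"
    using m by (rule convex_in_loss)
  finally show ?thesis by (simp add: algebra_simps)
qed

lemma pairs_quadratic_dim8:
  fixes a u m :: real
  assumes "0 \<le> m" "m \<le> u" "u \<le> a" "a + u \<le> 14143 / 10000"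
  shows "a\<^sup>2 + u\<^sup>2 + (u * (28285/10000 - a - u) + m * (28285/10000 - a - u + 2 * m - 4 * u)) \<le> 16 / 7"
proof -
  have u: "0 \<le> u" "u \<le> 14143 / 20000" using assms by linarith+
  have "0 \<le> u * (14143 / 20000 - u)" using u by simp
  then show ?thesis using pairs_quadratic[OF assms, of "28285/10000" 4] u
    by (auto simp: max_def power2_eq_square algebra_simps split: if_splits)
qed

lemma pairs_quadratic_dim9:
  fixes a u m :: real
  assumes "0 \<le> m" "m \<le> u" "u \<le> a" "a + u \<le> 14143 / 10000"
  shows "a\<^sup>2 + u\<^sup>2 + (u * (3 - a - u) + m * (3 - a - u + 2 * m - 4 * u)) \<le> 9 / 4"
proof -
  have u: "0 \<le> u" "u \<le> 14143 / 20000" using assms by linarith+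
  have "0 \<le> u * (14143 / 20000 - u)" using u by simp
  then show ?thesis using pairs_quadratic[OF assms, of "3" 4] u
    by (auto simp: max_def power2_eq_square algebra_simps split: if_splits)
qed

text \<open>
  For \<open>u\<close> close to \<open>sqrt 2 / 2\<close> this estimate is too weak, since it treats all entries of the tail as if they could
  equal \<open>u\<close>. That range is left to \<open>pairs_sharp_dim10\<close>, which keeps four entries in the head.
\<close>

lemma pairs_quadratic_dim10:
  fixes a u m :: real
  assumes "0 \<le> m" "m \<le> u" "u \<le> a" "a + u \<le> 14143 / 10000" "u \<le> 69 / 100"
  shows "a\<^sup>2 + u\<^sup>2 + (u * (31623/10000 - a - u) + m * (31623/10000 - a - u + 2 * m - 6 * u)) \<le> 20 / 9"
proof -
  have u: "0 \<le> u" using assms by linarith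
  \<comment> \<open>The parabola in the case \<open>m = 0\<close> is bounded by a chord, the one in the case \<open>m = u\<close> by a tangent at \<open>1/6\<close>.\<close>
  have "0 \<le> u * (69 / 100 - u)" "0 \<le> (u - 1/6)\<^sup>2" using u assms by simp_all
  then show ?thesis using pairs_quadratic[OF assms(1-4), of "31623/10000" 6] u assms(5)
    by (auto simp: max_def power2_eq_square algebra_simps split: if_splits)
qed

text \<open>
  The two largest entries use up so much of the total that at most two further entries can come close to \<open>u\<close>: the
  sum of squares is at most that of \<open>a, u, u, u\<close> and the rest \<open>h - a - 3 * u\<close> in a single entry.
\<close>

lemma pairs_sharp_dim10:
  fixes a u v b c T :: real
  assumes "0 \<le> v" "v \<le> c" "c \<le> b" "b \<le> u" "u \<le> a" "a + u \<le> 14143 / 10000" "69 / 100 \<le> u"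
    and T: "T = 31623/10000 - a - u - b - c"
  shows "a\<^sup>2 + u\<^sup>2 + b\<^sup>2 + c\<^sup>2 + (2 * v * T - v\<^sup>2) \<le> 20 / 9"
proof -
  have "0 \<le> (b - v) * (u - b)" "0 \<le> (c - v) * (u - c)" "0 \<le> (u - v) * (2 * u - b - c)"
    using assms by (auto intro!: mult_nonneg_nonneg)
  moreover have "0 \<le> (31623/10000 - a - 3 * u - v)\<^sup>2" by simp
  ultimately have "a\<^sup>2 + u\<^sup>2 + b\<^sup>2 + c\<^sup>2 + (2 * v * T - v\<^sup>2) \<le> a\<^sup>2 + 3 * u\<^sup>2 + (31623/10000 - a - 3 * u)\<^sup>2"
    unfolding T by (simp add: algebra_simps power2_eq_square)
  \<comment> \<open>For \<open>u \<ge> 0.69\<close> one has \<open>a \<le> 1.4143 - 0.69\<close> and \<open>h - a - 3 * u \<le> 3.1623 - 4 * 0.69\<close>; also \<open>u \<le> 1.4143 / 2\<close>.\<close>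
  also have "\<dots> \<le> (7243/10000)\<^sup>2 + 3 * (7072/10000)\<^sup>2 + (4023/10000)\<^sup>2"
    using assms by (intro add_mono mult_left_mono power_mono) auto
  also have "\<dots> \<le> 20 / 9" by (simp add: power2_eq_square)
  finally show ?thesis .
qed

lemma w_8_le: "w TYPE(8) \<le> 240"
proof (rule w_le_of_parity[where K = "{2}" and L = "{}" and h = 0 and m = 8 and n = 8])
  show "(\<Sum>k\<in>{2}. 2 ^ k * (8 choose k)) + (\<Sum>k\<in>{}. 2 ^ k * ((0 choose k) + ((8 - 0) choose k))) + 2 ^ (8 - 1) \<le> (240::nat)"
    by (simp add: binomial_fact' fact_numeral)
  fix z :: "nat \<Rightarrow> real"
  assume dec: "\<And>i j. i \<le> j \<Longrightarrow> j < 8 \<Longrightarrow> z j \<le> z i" and nonneg: "\<And>i. 0 \<le> z i"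
    and K: "\<And>k. k \<in> {2} \<Longrightarrow> (\<Sum>i<k. z i) \<le> sqrt k" and h: "(\<Sum>i<8. z i) - 2 * z (8 - 1) \<le> sqrt (8::nat)"
  have r: "z 0 + z 1 \<le> 14143/10000" using K[of 2] sqrt_bounds(1) by (simp add: sum_numerals_unfold)
  have h': "(\<Sum>i<8. z i) - 2 * z 7 \<le> 28285/10000" using h sqrt_bounds(4) by simp
  have u: "z 2 \<le> z 1" "z 1 \<le> z 0" using dec by auto
  note tail = tail_bound_head[OF dec nonneg _ _ u(1) h' refl, simplified sum_numerals_unfold]
  have "(\<Sum>i<8. (z i)\<^sup>2) \<le> 16 / 7"
    using tail(1) pairs_quadratic_dim8[OF tail(3,4) u(2) r] by (simp add: algebra_simps)
  then show "(\<Sum>i<8. (z i)\<^sup>2) \<le> 2 * real 8 / (real 8 - 1)" by simp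
qed auto

lemma w_9_le: "w TYPE(9) \<le> 470"
proof (rule w_le_of_parity[where K = "{2}" and L = "{}" and h = 0 and m = 8 and n = 9])
  show "(\<Sum>k\<in>{2}. 2 ^ k * (9 choose k)) + (\<Sum>k\<in>{}. 2 ^ k * ((0 choose k) + ((9 - 0) choose k))) + 2 ^ (9 - 1) \<le> (470::nat)"
    by (simp add: binomial_fact' fact_numeral)
  fix z :: "nat \<Rightarrow> real"
  assume dec: "\<And>i j. i \<le> j \<Longrightarrow> j < 9 \<Longrightarrow> z j \<le> z i" and nonneg: "\<And>i. 0 \<le> z i"
    and K: "\<And>k. k \<in> {2} \<Longrightarrow> (\<Sum>i<k. z i) \<le> sqrt k"
    and h: "(\<Sum>i<9. z i) - 2 * z (8 - 1) \<le> sqrt (9::nat)"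
  have r: "z 0 + z 1 \<le> 14143/10000" using K[of 2] sqrt_bounds(1) by (simp add: sum_numerals_unfold)
  have h': "(\<Sum>i<9. z i) - 2 * z 7 \<le> 3" using h by simp
  have u: "z 2 \<le> z 1" "z 1 \<le> z 0" using dec by auto
  note tail = tail_bound_head[OF dec nonneg _ _ u(1) h' refl, simplified sum_numerals_unfold]
  have "(\<Sum>i<9. (z i)\<^sup>2) \<le> 9 / 4"
    using tail(1) pairs_quadratic_dim9[OF tail(3,4) u(2) r] by (simp add: algebra_simps)
  then show "(\<Sum>i<9. (z i)\<^sup>2) \<le> 2 * real 9 / (real 9 - 1)" by simp
qed auto

lemma w_10_le: "w TYPE(10) \<le> 692"
proof (rule w_le_of_parity[where K = "{2}" and L = "{}" and h = 0 and m = 10 and n = 10])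
  show "(\<Sum>k\<in>{2}. 2 ^ k * (10 choose k)) + (\<Sum>k\<in>{}. 2 ^ k * ((0 choose k) + ((10 - 0) choose k))) + 2 ^ (10 - 1) \<le> (692::nat)"
    by (simp add: binomial_fact' fact_numeral)
  fix z :: "nat \<Rightarrow> real"
  assume dec: "\<And>i j. i \<le> j \<Longrightarrow> j < 10 \<Longrightarrow> z j \<le> z i" and nonneg: "\<And>i. 0 \<le> z i"
    and K: "\<And>k. k \<in> {2} \<Longrightarrow> (\<Sum>i<k. z i) \<le> sqrt k"
    and h: "(\<Sum>i<10. z i) - 2 * z (10 - 1) \<le> sqrt (10::nat)"
  have r: "z 0 + z 1 \<le> 14143/10000" using K[of 2] sqrt_bounds(1) by (simp add: sum_numerals_unfold)
  have h': "(\<Sum>i<10. z i) - 2 * z 9 \<le> 31623/10000" using h sqrt_bounds(5) by simp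
  have u: "z 2 \<le> z 1" "z 1 \<le> z 0" using dec by auto
  note tail = tail_bound_head[OF dec nonneg _ _ u(1) h' refl, simplified sum_numerals_unfold]
  have "(\<Sum>i<10. (z i)\<^sup>2) \<le> 20 / 9"
  proof (cases "z 1 \<le> 69/100")
    case True
    then show ?thesis using tail(1) pairs_quadratic_dim10[OF tail(3,4) u(2) r] by (simp add: algebra_simps)
  next
    case False
    define T where "T = 31623/10000 - (z 0 + z 1 + z 2 + z 3)"
    note tail4 = tail_bound_head[OF dec nonneg _ _ order_refl[of "z 4"] h' refl, simplified sum_numerals_unfold, folded T_def]
    have "z 4 * T + z 9 * (T + 2 * z 9 - 4 * z 4) \<le> 2 * z 4 * T - (z 4)\<^sup>2"
      using tail4(2-4) by (intro tail_bound_sharp) auto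
    moreover have "(z 0)\<^sup>2 + (z 1)\<^sup>2 + (z 2)\<^sup>2 + (z 3)\<^sup>2 + (2 * z 4 * T - (z 4)\<^sup>2) \<le> 20 / 9"
      using False r dec nonneg by (intro pairs_sharp_dim10) (auto simp: T_def)
    ultimately show ?thesis using tail4(1) by (simp add: algebra_simps)
  qed
  then show "(\<Sum>i<10. (z i)\<^sup>2) \<le> 2 * real 10 / (real 10 - 1)" by simp
qed auto

section \<open>Dimension 11: pairs and split triples\<close>

lemma split_triples_plain:
  fixes u e :: real
  assumes "0 \<le> e" "e \<le> u" "u \<le> 14143/20000" "3 * e \<le> 17321/10000"
    and q: "q \<le> 2 * u" "q \<le> 17321/10000 - e"
  shows "(14143/10000)\<^sup>2 - 2 * (14143/10000) * u + 2 * u\<^sup>2 + u * q - 2 * u * e + e * (33167/10000 - 14143/10000) \<le> 11 / 5"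
proof (cases "e \<le> 17321/10000 - 2 * u")
  case True
  have "u * q \<le> u * (2 * u)" using q assms by (intro mult_left_mono) auto
  moreover have "0 \<le> (17321/10000 - 2 * u - e) * (19024/10000 - 2 * u)" "0 \<le> (14143/20000 - u) * (u - e)"
    "0 \<le> (u - e) * (19024/10000 - 2 * u)" "0 \<le> (14143/20000 - u) * u"  "0 \<le> (14143/20000 - u) * (17321/10000 - 2 * u - e)"
    "0 \<le> (17321/10000 - 2 * u - e) * u" "0 \<le> (u - e) * u"
    using True assms by (auto intro!: mult_nonneg_nonneg)
  ultimately show ?thesis using assms True by (simp add: algebra_simps power2_eq_square add_divide_distrib diff_divide_distrib)
next
  case False
  have "u * q \<le> u * (17321/10000 - e)" using q assms by (intro mult_left_mono) auto
  moreover have "0 \<le> (e + 2 * u - 17321/10000) * (14143/20000 - u)" "0 \<le> (17321/10000 - 3 * e) * (14143/20000 - u)"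
    "0 \<le> (e + 2 * u - 17321/10000) * (17321/10000 - 3 * e)" "0 \<le> (u - e) * (14143/20000 - u)" "0 \<le> (u - e) * (17321/10000 - 3 * e)"
    "0 \<le> (e + 2 * u - 17321/10000) * (u - e)"
    using False assms by (auto intro!: mult_nonneg_nonneg)
  ultimately show ?thesis using assms False by (simp add: algebra_simps power2_eq_square add_divide_distrib diff_divide_distrib)
qed

lemma split_triples_loss:
  fixes u e :: real
  assumes "0 \<le> e" "e \<le> u" "u \<le> 14143/20000"
  shows "(14143/10000)\<^sup>2 - 2 * (14143/10000) * u + 4 * u\<^sup>2 - 4 * u * e - 2 * e\<^sup>2 + 2 * e * (33167/10000 - 14143/10000) \<le> 11 / 5"
proof (cases "u \<le> 45/100")
  case True
  have "0 \<le> (u - e) * (38048/10000 - 6 * u - 2 * e)" "0 \<le> (u - 1/4)\<^sup>2"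
    using True assms by (auto intro!: mult_nonneg_nonneg)
  then show ?thesis using assms True by (simp add: algebra_simps power2_eq_square add_divide_distrib diff_divide_distrib)
next
  case False
  have "0 \<le> (e + u - 951/1000)\<^sup>2" "0 \<le> (u - 45/100) * (14143/20000 - u)"
    using False assms by (auto intro!: mult_nonneg_nonneg)
  then show ?thesis using assms False by (simp add: algebra_simps power2_eq_square add_divide_distrib diff_divide_distrib)
qed

text \<open>
  The entries \<open>a \<ge> u \<ge> b \<ge> c \<ge> e\<close> form the head, with \<open>b + c + e\<close> bounded by the split triples. As before only
  the extreme values \<open>m = 0\<close> (case \<open>plain\<close>) and \<open>m = e\<close> (case \<open>loss\<close>) of the lost entry matter; eliminating \<open>a\<close>
  and then \<open>b, c\<close> leaves the two inequalities in \<open>u, e\<close> above.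
\<close>

lemma split_triples_quadratic:
  fixes a u b c e m T :: real
  assumes "0 \<le> m" "m \<le> e" "e \<le> c" "c \<le> b" "b \<le> u" "u \<le> a" "a + u \<le> 14143/10000" "b + c + e \<le> 17321/10000"
    and T: "T = 33167/10000 - a - u - b - c - e"
  shows "a\<^sup>2 + u\<^sup>2 + b\<^sup>2 + c\<^sup>2 + e\<^sup>2 + (e * T + m * (T + 2 * m - 3 * e)) \<le> 11 / 5"
proof -
  define r h :: real where "r = 14143/10000" and "h = 33167/10000"
  have bc: "b\<^sup>2 + c\<^sup>2 \<le> (u + e) * (b + c) - 2 * u * e"
  proof -
    have "0 \<le> (b - e) * (u - b)" "0 \<le> (c - e) * (u - c)" using assms by (auto intro!: mult_nonneg_nonneg)
    then show ?thesis by (simp add: algebra_simps power2_eq_square add_divide_distrib diff_divide_distrib)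
  qed
  have "m * (T - 3 * e + 2 * m) \<le> max 0 (e * (T - 3 * e + 2 * e))"
    using assms by (intro convex_in_loss) auto
  then consider (plain) "m * (T + 2 * m - 3 * e) \<le> 0" | (loss) "m * (T + 2 * m - 3 * e) \<le> e * (T - e)"
    by (auto simp: max_def algebra_simps split: if_splits)
  then show ?thesis
  proof cases
    case plain
    have "0 \<le> (r - u - a) * (r - u + a - e)" using assms by (intro mult_nonneg_nonneg) (auto simp: r_def)
    then have "a\<^sup>2 + u\<^sup>2 + b\<^sup>2 + c\<^sup>2 + e\<^sup>2 + e * T \<le> r\<^sup>2 - 2 * r * u + 2 * u\<^sup>2 + u * (b + c) - 2 * u * e + e * (h - r)"
      using bc unfolding T h_def[symmetric] by (simp add: algebra_simps power2_eq_square add_divide_distrib diff_divide_distrib)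
    moreover have "\<dots> \<le> 11 / 5"
      unfolding r_def h_def using assms by (intro split_triples_plain) auto
    ultimately show ?thesis using plain by linarith
  next
    case loss
    have "0 \<le> (r - u - a) * (r - u + a - 2 * e)" "0 \<le> (u - e) * (2 * u - b - c)"
      using assms by (auto intro!: mult_nonneg_nonneg simp: r_def)
    then have "a\<^sup>2 + u\<^sup>2 + b\<^sup>2 + c\<^sup>2 + e\<^sup>2 + (e * T + e * (T - e)) \<le> r\<^sup>2 - 2 * r * u + 4 * u\<^sup>2 - 4 * u * e - 2 * e\<^sup>2 + 2 * e * (h - r)"
      using bc unfolding T h_def[symmetric] by (simp add: algebra_simps power2_eq_square add_divide_distrib diff_divide_distrib)
    moreover have "\<dots> \<le> 11 / 5"
      unfolding r_def h_def using assms by (intro split_triples_loss) auto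
    ultimately show ?thesis using loss by linarith
  qed
qed

lemma w_11_le: "w TYPE(11) \<le> 2024"
proof (rule w_le_of_parity[where K = "{2}" and L = "{3}" and h = 6 and m = 10 and n = 11])
  show "(\<Sum>k\<in>{2}. 2 ^ k * (11 choose k)) + (\<Sum>k\<in>{3}. 2 ^ k * ((6 choose k) + ((11 - 6) choose k))) + 2 ^ (11 - 1) \<le> (2024::nat)"
    by (simp add: binomial_fact' fact_numeral)
  fix z :: "nat \<Rightarrow> real"
  assume dec: "\<And>i j. i \<le> j \<Longrightarrow> j < 11 \<Longrightarrow> z j \<le> z i" and nonneg: "\<And>i. 0 \<le> z i"
    and K: "\<And>k. k \<in> {2} \<Longrightarrow> (\<Sum>i<k. z i) \<le> sqrt k"
    and L: "\<And>k. k \<in> {3} \<Longrightarrow> (\<Sum>i\<in>{k - 1..<2 * k - 1}. z i) \<le> sqrt k"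
    and h: "(\<Sum>i<11. z i) - 2 * z (10 - 1) \<le> sqrt (11::nat)"
  have r: "z 0 + z 1 \<le> 14143/10000" using K[of 2] sqrt_bounds(1) by (simp add: sum_numerals_unfold)
  have q: "z 2 + z 3 + z 4 \<le> 17321/10000" using L[of 3] sqrt_bounds(2) by (simp add: sum_numerals_unfold)
  have h': "(\<Sum>i<11. z i) - 2 * z 9 \<le> 33167/10000" using h sqrt_bounds(6) by simp
  define T where "T = 33167/10000 - (z 0 + z 1 + z 2 + z 3 + z 4)"
  have u: "z 5 \<le> z 4" using dec by simp
  note tail = tail_bound_head[OF dec nonneg _ _ u h' refl, simplified sum_numerals_unfold sum_lessThan_5, folded T_def]
  have "(z 0)\<^sup>2 + (z 1)\<^sup>2 + (z 2)\<^sup>2 + (z 3)\<^sup>2 + (z 4)\<^sup>2 + (z 4 * T + z 9 * (T + 2 * z 9 - 3 * z 4)) \<le> 11 / 5"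
    using tail(3,4) r q dec by (intro split_triples_quadratic) (auto simp: T_def)
  then have "(\<Sum>i<11. (z i)\<^sup>2) \<le> 11 / 5" using tail(1) by simp
  then show "(\<Sum>i<11. (z i)\<^sup>2) \<le> 2 * real 11 / (real 11 - 1)" by simp
qed auto

section \<open>Dimensions 12 to 14: triples\<close>

text \<open>
  The analogue of \<open>pairs_quadratic\<close> for a head of three entries. Since \<open>a, b \<le> 1\<close>, the products in the proof bound
  the squares of the head linearly.
\<close>

lemma triples_quadratic:
  fixes a b u m h r q :: real
  assumes m: "0 \<le> m" "m \<le> u" and ab: "u \<le> b" "b \<le> a" "a \<le> 1" "a + b + u \<le> r"
  shows "a\<^sup>2 + b\<^sup>2 + u\<^sup>2 + (u * (h - a - b - u) + m * (h - a - b - u + 2 * m - q * u))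
    \<le> r + u * (h - 3) + max 0 (u * (h - r + 2 * u - q * u))"
proof -
  have "0 \<le> (1 - a) * (a - u)" "0 \<le> (1 - b) * (b - u)" "0 \<le> (1 - m) * (r - a - b - u)"
    using assms by (intro mult_nonneg_nonneg; simp)+
  then have "a\<^sup>2 + b\<^sup>2 + u\<^sup>2 + (u * (h - a - b - u) + m * (h - a - b - u + 2 * m - q * u))
    \<le> r + u * (h - 3) + m * (h - r - q * u + 2 * m)"
    by (simp add: algebra_simps power2_eq_square add_divide_distrib diff_divide_distrib)
  also have "m * (h - r - q * u + 2 * m) \<le> max 0 (u * (h - r - q * u + 2 * u))"
    using m by (rule convex_in_loss)
  finally show ?thesis by (simp add: algebra_simps)
qed

lemma triples_quadratic_dim12:
  fixes a b u m :: real
  assumes "0 \<le> m" "m \<le> u" "u \<le> b" "b \<le> a" "a \<le> 1" "a + b + u \<le> 17321 / 10000"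
  shows "a\<^sup>2 + b\<^sup>2 + u\<^sup>2 + (u * (34642/10000 - a - b - u) + m * (34642/10000 - a - b - u + 2 * m - 7 * u)) \<le> 24 / 11"
proof -
  \<comment> \<open>The bound is a concave parabola in \<open>u\<close>, with its maximum near \<open>0.22\<close>.\<close>
  have "0 \<le> (u - 22/100)\<^sup>2" by simp
  then show ?thesis using triples_quadratic[OF assms, of "34642/10000" 7] assms
    by (auto simp: max_def power2_eq_square algebra_simps split: if_splits)
qed

lemma triples_quadratic_dim13:
  fixes a b u m :: real
  assumes "0 \<le> m" "m \<le> u" "u \<le> b" "b \<le> a" "a \<le> 1" "a + b + u \<le> 17321 / 10000"
  shows "a\<^sup>2 + b\<^sup>2 + u\<^sup>2 + (u * (36056/10000 - a - b - u) + m * (36056/10000 - a - b - u + 2 * m - 7 * u)) \<le> 13 / 6"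
proof -
  have "0 \<le> (u - 25/100)\<^sup>2" by simp
  then show ?thesis using triples_quadratic[OF assms, of "36056/10000" 7] assms
    by (auto simp: max_def power2_eq_square algebra_simps split: if_splits)
qed

text \<open>
  The range of \<open>u\<close> near its maximum \<open>sqrt 3 / 3\<close> is left to \<open>triples_sharp_dim14\<close>.
\<close>

lemma triples_quadratic_dim14:
  fixes a b u m :: real
  assumes "0 \<le> m" "m \<le> u" "u \<le> b" "b \<le> a" "a \<le> 1" "a + b + u \<le> 17321 / 10000" "u \<le> 568 / 1000"
  shows "a\<^sup>2 + b\<^sup>2 + u\<^sup>2 + (u * (37417/10000 - a - b - u) + m * (37417/10000 - a - b - u + 2 * m - 9 * u)) \<le> 28 / 13"
proof -
  have "0 \<le> (u - 2/10)\<^sup>2" by simp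
  then show ?thesis using triples_quadratic[OF assms(1-6), of "37417/10000" 9] assms
    by (auto simp: max_def power2_eq_square algebra_simps split: if_splits)
qed

text \<open>
  As in \<open>pairs_sharp_dim10\<close>, the sum of squares is at most that of \<open>a, b\<close>, four entries \<open>u\<close> and a single entry holding
  the rest.
\<close>

lemma triples_sharp_dim14:
  fixes a b u c d e v T :: real
  assumes "0 \<le> v" "v \<le> e" "e \<le> d" "d \<le> c" "c \<le> u" "u \<le> b" "b \<le> a" "a + b + u \<le> 17321 / 10000" "568 / 1000 \<le> u"
    and T: "T = 37417/10000 - a - b - u - c - d - e"
  shows "a\<^sup>2 + b\<^sup>2 + u\<^sup>2 + c\<^sup>2 + d\<^sup>2 + e\<^sup>2 + (2 * v * T - v\<^sup>2) \<le> 28 / 13"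
proof -
  have "0 \<le> (c - v) * (u - c)" "0 \<le> (d - v) * (u - d)" "0 \<le> (e - v) * (u - e)" "0 \<le> (u - v) * (3 * u - c - d - e)"
    using assms by (auto intro!: mult_nonneg_nonneg)
  moreover have "0 \<le> (37417/10000 - a - b - 4 * u - v)\<^sup>2" by simp
  ultimately have "a\<^sup>2 + b\<^sup>2 + u\<^sup>2 + c\<^sup>2 + d\<^sup>2 + e\<^sup>2 + (2 * v * T - v\<^sup>2)
      \<le> a\<^sup>2 + b\<^sup>2 + 4 * u\<^sup>2 + (37417/10000 - a - b - 4 * u)\<^sup>2"
    unfolding T by (simp add: algebra_simps power2_eq_square add_divide_distrib diff_divide_distrib)
  \<comment> \<open>For \<open>u \<ge> 0.568\<close>: \<open>a \<le> 1.7321 - 2 * u\<close>, \<open>b \<le> (1.7321 - u) / 2\<close>, \<open>u \<le> 1.7321 / 3\<close> and \<open>a + b + 4 * u \<ge> 6 * u\<close>.\<close>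
  also have "\<dots> \<le> (5961/10000)\<^sup>2 + (58205/100000)\<^sup>2 + 4 * (57737/100000)\<^sup>2 + (3337/10000)\<^sup>2"
    using assms by (intro add_mono mult_left_mono power_mono) auto
  also have "\<dots> \<le> 28 / 13" by (simp add: power2_eq_square)
  finally show ?thesis .
qed

lemma w_12_le: "w TYPE(12) \<le> 3832"
proof (rule w_le_of_parity[where K = "{1,3}" and L = "{}" and h = 0 and m = 12 and n = 12])
  show "(\<Sum>k\<in>{1,3}. 2 ^ k * (12 choose k)) + (\<Sum>k\<in>{}. 2 ^ k * ((0 choose k) + ((12 - 0) choose k))) + 2 ^ (12 - 1) \<le> (3832::nat)"
    by (simp add: binomial_fact' fact_numeral)
  fix z :: "nat \<Rightarrow> real"
  assume dec: "\<And>i j. i \<le> j \<Longrightarrow> j < 12 \<Longrightarrow> z j \<le> z i" and nonneg: "\<And>i. 0 \<le> z i"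
    and K: "\<And>k. k \<in> {1,3} \<Longrightarrow> (\<Sum>i<k. z i) \<le> sqrt k"
    and h: "(\<Sum>i<12. z i) - 2 * z (12 - 1) \<le> sqrt (12::nat)"
  have a: "z 0 \<le> 1" using K[of 1] by simp
  have r: "z 0 + z 1 + z 2 \<le> 17321/10000" using K[of 3] sqrt_bounds(2) by (simp add: sum_numerals_unfold)
  have h': "(\<Sum>i<12. z i) - 2 * z 11 \<le> 34642/10000" using h sqrt_bounds(7) by simp
  have u: "z 3 \<le> z 2" "z 2 \<le> z 1" "z 1 \<le> z 0" using dec by auto
  note tail = tail_bound_head[OF dec nonneg _ _ u(1) h' refl, simplified sum_numerals_unfold]
  have "(\<Sum>i<12. (z i)\<^sup>2) \<le> 24 / 11"
    using tail(1) triples_quadratic_dim12[OF tail(3,4) u(2,3) a r] by (simp add: algebra_simps)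
  then show "(\<Sum>i<12. (z i)\<^sup>2) \<le> 2 * real 12 / (real 12 - 1)" by simp
qed auto

lemma w_13_le: "w TYPE(13) \<le> 7074"
proof (rule w_le_of_parity[where K = "{1,3}" and L = "{}" and h = 0 and m = 12 and n = 13])
  show "(\<Sum>k\<in>{1,3}. 2 ^ k * (13 choose k)) + (\<Sum>k\<in>{}. 2 ^ k * ((0 choose k) + ((13 - 0) choose k))) + 2 ^ (13 - 1) \<le> (7074::nat)"
    by (simp add: binomial_fact' fact_numeral)
  fix z :: "nat \<Rightarrow> real"
  assume dec: "\<And>i j. i \<le> j \<Longrightarrow> j < 13 \<Longrightarrow> z j \<le> z i" and nonneg: "\<And>i. 0 \<le> z i"
    and K: "\<And>k. k \<in> {1,3} \<Longrightarrow> (\<Sum>i<k. z i) \<le> sqrt k"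
    and h: "(\<Sum>i<13. z i) - 2 * z (12 - 1) \<le> sqrt (13::nat)"
  have a: "z 0 \<le> 1" using K[of 1] by simp
  have r: "z 0 + z 1 + z 2 \<le> 17321/10000" using K[of 3] sqrt_bounds(2) by (simp add: sum_numerals_unfold)
  have h': "(\<Sum>i<13. z i) - 2 * z 11 \<le> 36056/10000" using h sqrt_bounds(8) by simp
  have u: "z 3 \<le> z 2" "z 2 \<le> z 1" "z 1 \<le> z 0" using dec by auto
  note tail = tail_bound_head[OF dec nonneg _ _ u(1) h' refl, simplified sum_numerals_unfold]
  have "(\<Sum>i<13. (z i)\<^sup>2) \<le> 13 / 6"
    using tail(1) triples_quadratic_dim13[OF tail(3,4) u(2,3) a r] by (simp add: algebra_simps)
  then show "(\<Sum>i<13. (z i)\<^sup>2) \<le> 2 * real 13 / (real 13 - 1)" by simp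
qed auto

lemma w_14_le: "w TYPE(14) \<le> 11132"
proof (rule w_le_of_parity[where K = "{1,3}" and L = "{}" and h = 0 and m = 14 and n = 14])
  show "(\<Sum>k\<in>{1,3}. 2 ^ k * (14 choose k)) + (\<Sum>k\<in>{}. 2 ^ k * ((0 choose k) + ((14 - 0) choose k))) + 2 ^ (14 - 1) \<le> (11132::nat)"
    by (simp add: binomial_fact' fact_numeral)
  fix z :: "nat \<Rightarrow> real"
  assume dec: "\<And>i j. i \<le> j \<Longrightarrow> j < 14 \<Longrightarrow> z j \<le> z i" and nonneg: "\<And>i. 0 \<le> z i"
    and K: "\<And>k. k \<in> {1,3} \<Longrightarrow> (\<Sum>i<k. z i) \<le> sqrt k"
    and h: "(\<Sum>i<14. z i) - 2 * z (14 - 1) \<le> sqrt (14::nat)"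
  have a: "z 0 \<le> 1" using K[of 1] by simp
  have r: "z 0 + z 1 + z 2 \<le> 17321/10000" using K[of 3] sqrt_bounds(2) by (simp add: sum_numerals_unfold)
  have h': "(\<Sum>i<14. z i) - 2 * z 13 \<le> 37417/10000" using h sqrt_bounds(9) by simp
  have u: "z 3 \<le> z 2" "z 2 \<le> z 1" "z 1 \<le> z 0" using dec by auto
  note tail = tail_bound_head[OF dec nonneg _ _ u(1) h' refl, simplified sum_numerals_unfold]
  have "(\<Sum>i<14. (z i)\<^sup>2) \<le> 28 / 13"
  proof (cases "z 2 \<le> 568/1000")
    case True
    then show ?thesis using tail(1) triples_quadratic_dim14[OF tail(3,4) u(2,3) a r] by (simp add: algebra_simps)
  next
    case False
    define T where "T = 37417/10000 - (z 0 + z 1 + z 2 + z 3 + z 4 + z 5)"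
    note tail6 = tail_bound_head[OF dec nonneg _ _ order_refl[of "z 6"] h' refl, simplified sum_numerals_unfold, folded T_def]
    have "z 6 * T + z 13 * (T + 2 * z 13 - 6 * z 6) \<le> 2 * z 6 * T - (z 6)\<^sup>2"
      using tail6(2-4) by (intro tail_bound_sharp) auto
    moreover have "(z 0)\<^sup>2 + (z 1)\<^sup>2 + (z 2)\<^sup>2 + (z 3)\<^sup>2 + (z 4)\<^sup>2 + (z 5)\<^sup>2 + (2 * z 6 * T - (z 6)\<^sup>2) \<le> 28 / 13"
      using False r dec nonneg by (intro triples_sharp_dim14) (auto simp: T_def)
    ultimately show ?thesis using tail6(1) by (simp add: algebra_simps)
  qed
  then show "(\<Sum>i<14. (z i)\<^sup>2) \<le> 2 * real 14 / (real 14 - 1)" by simp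
qed auto

section \<open>Dimension 15: triples, split quadruples and weights modulo 3\<close>

text \<open>
  A variant of \<open>tail_bound\<close> for a correction of signs that costs \<open>l\<close>, where \<open>l\<close> is at most the sum of the two
  smallest entries. The larger of these, \<open>m\<close>, is a lower bound for the other entries of the tail.
\<close>

lemma tail_bound_two:
  fixes z :: "nat \<Rightarrow> real"
  assumes dec: "\<And>i j. i \<le> j \<Longrightarrow> j < n \<Longrightarrow> z j \<le> z i" and nonneg: "\<And>i. 0 \<le> z i"
    and k: "k + 2 < n" and u: "z k \<le> u" and m: "m = z (n - 2)"
    and l: "0 \<le> l" "l \<le> m + z (n - 1)"
    and T: "(\<Sum>i\<in>{k..<n}. z i) \<le> T + 2 * l"
  shows "(\<Sum>i\<in>{k..<n}. (z i)\<^sup>2) \<le> u * T + (m * T + 2 * m * l + u * l - real (n - 2 - k) * (u * m))"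
    and "real (n - 2 - k) * m \<le> T + l"
proof -
  obtain N where N: "n = N + 2" using k by (metis add.commute add_lessD1 less_imp_add_positive less_iff_Suc_add add_2_eq_Suc')
  have kN: "k < N" using k N by simp
  have split: "(\<Sum>i\<in>{k..<n}. f i) = (\<Sum>i\<in>{k..<N}. f i) + f N + f (Suc N)" for f :: "nat \<Rightarrow> real"
    using kN by (simp add: N)
  define S where "S = (\<Sum>i\<in>{k..<N}. z i)"
  define v where "v = z (Suc N)"
  have m': "m = z N" using m N by simp
  have v: "0 \<le> v" "v \<le> m" "l \<le> m + v" using nonneg dec[of N "Suc N"] l N by (auto simp: v_def m')
  have mu: "0 \<le> m" "m \<le> u" using nonneg dec[of k N] u kN N by (auto simp: m')
  have S: "S + m + v \<le> T + 2 * l" using T unfolding split S_def v_def m' .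
  have "(\<Sum>i\<in>{k..<N}. (z i)\<^sup>2) \<le> (u + m) * S - card {k..<N} * (u * m)"
    unfolding S_def
  proof (rule sum_squares_between)
    show "m \<le> z i" if "i \<in> {k..<N}" for i using dec[of i N] that N by (simp add: m')
    show "z i \<le> u" if "i \<in> {k..<N}" for i using dec[of k i] that N u by simp
  qed
  moreover have "v\<^sup>2 \<le> m * v" unfolding power2_eq_square using v by (intro mult_right_mono) auto
  ultimately have "(\<Sum>i\<in>{k..<n}. (z i)\<^sup>2) \<le> (u + m) * S - real (N - k) * (u * m) + m * (m + v)"
    unfolding split[of "\<lambda>i. (z i)\<^sup>2"] v_def[symmetric] m'[symmetric]
    by (simp add: algebra_simps power2_eq_square)
  also have "\<dots> \<le> (u + m) * (T + 2 * l - m - v) - real (N - k) * (u * m) + m * (m + v)"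
    using S mu by (intro add_right_mono diff_right_mono mult_left_mono) auto
  also have "\<dots> = u * T + (m * T + 2 * m * l + u * l - real (N - k) * (u * m)) - u * (m + v - l)"
    by (simp add: algebra_simps)
  also have "\<dots> \<le> u * T + (m * T + 2 * m * l + u * l - real (N - k) * (u * m))"
    using v mu by simp
  finally show "(\<Sum>i\<in>{k..<n}. (z i)\<^sup>2) \<le> u * T + (m * T + 2 * m * l + u * l - real (n - 2 - k) * (u * m))"
    by (simp add: N)
  have "(\<Sum>i\<in>{k..<N}. m) \<le> S" unfolding S_def
  proof (rule sum_mono)
    show "m \<le> z i" if "i \<in> {k..<N}" for i using dec[of i N] that N by (simp add: m')
  qed
  then show "real (n - 2 - k) * m \<le> T + l" using S v N by simp
qed

text \<open>
  Multiples of 3 allow the signs to be corrected at any two prescribed coordinates, as \<open>r\<close>, \<open>r + 1\<close> or \<open>r + 2\<close> is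
  one. The weights 1 and 14 are there for corrections at a single coordinate: without them, a single negative sign
  at the largest coordinate could be corrected only there or at two other coordinates.
\<close>

definition weights15 :: "nat set" where
  "weights15 = {0, 1, 3, 6, 9, 12, 14, 15}"

definition code15 :: "nat set set" where
  "code15 = {Z. Z \<subseteq> {..<15} \<and> card Z \<in> weights15}"

lemma card_code15: "card code15 \<le> 10952"
proof -
  have "code15 = (\<Union>k\<in>weights15. k_sets 15 k)" by (auto simp: code15_def k_sets_def)
  then have "card code15 \<le> (\<Sum>k\<in>weights15. card (k_sets 15 k))"
    using card_UN_le[of weights15 "k_sets 15"] by (simp add: weights15_def)
  also have "\<dots> = (\<Sum>k\<in>weights15. 15 choose k)"
    by (simp only: card_k_sets)
  also have "\<dots> = 10952" by (simp add: weights15_def binomial_fact' fact_numeral)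
  finally show ?thesis .
qed

lemma code15_compl: "Z \<in> code15 \<Longrightarrow> {..<15} - Z \<in> code15"
proof -
  assume Z: "Z \<in> code15"
  then have "Z \<subseteq> {..<15}" by (simp add: code15_def)
  then have "card ({..<15} - Z) = 15 - card Z" using finite_subset[of Z "{..<15}"] by (simp add: card_Diff_subset)
  then show ?thesis using Z by (auto simp: code15_def weights15_def)
qed

text \<open>
  Two ways to reach a codeword: by choosing the signs at the two smallest coordinates, or by changing one sign at a
  coordinate outside the three largest. The latter is possible because a negative sign is removed only when
  at least four are present, and one is added only when at least four positive signs are present.
\<close>

lemma code15_loss:
  fixes a :: "nat \<Rightarrow> real" and p :: "nat \<Rightarrow> nat"
  assumes p: "bij_betw p {..<15} {..<15}" and dec: "\<And>i j. i \<le> j \<Longrightarrow> j < 15 \<Longrightarrow> a (p j) \<le> a (p i)"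
    and a: "\<And>i. 0 \<le> a i" and Z: "Z \<subseteq> {..<15}"
    and C: "\<And>T. T \<subseteq> {..<15} \<Longrightarrow> sym_diff Z T \<in> code15 \<Longrightarrow> (\<Sum>i<15. a i) - 2 * (\<Sum>i\<in>T. a i) \<le> h"
  shows "\<exists>l\<ge>0. l \<le> a (p 3) \<and> l \<le> a (p 13) + a (p 14) \<and> (\<Sum>i<15. a (p i)) \<le> h + 2 * l"
proof -
  have reindex: "(\<Sum>i<15. a (p i)) = (\<Sum>i<15. a i)" using sum.reindex_bij_betw[OF p] .
  have inj: "inj_on p {..<15}" and pn: "\<And>i. i < 15 \<Longrightarrow> p i < 15" and surj: "p ` {..<15} = {..<15}"
    using p by (auto simp: bij_betw_def)
  have finZ: "finite Z" and cardZ: "card Z \<le> 15"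
    using Z finite_subset card_mono[OF _ Z] by auto
  have "(\<Sum>i<15. a i) \<le> h + 2 * (a (p 13) + a (p 14))"
  proof -
    have ij: "p 13 \<noteq> p 14" using inj_onD[OF inj, of 13 14] by auto
    define R where "R = Z - {p 13, p 14}"
    have R: "finite R" "p 13 \<notin> R" "p 14 \<notin> R" "R \<subseteq> {..<15} - {p 13, p 14}" using finZ Z by (auto simp: R_def)
    have "card ({..<15} - {p 13, p 14}) = 13" using ij pn[of 13] pn[of 14] by (simp add: card_Diff_subset)
    then have cR: "card R \<le> 13" using card_mono[OF _ R(4)] by simp
    obtain E where E: "E \<subseteq> {p 13, p 14}" "card (R \<union> E) \<in> weights15"
    proof -
      have "card R \<in> weights15 \<or> card R + 1 \<in> weights15 \<or> card R + 2 \<in> weights15"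
        using cR by (auto simp: weights15_def) presburger
      then show thesis
        using that[of "{}"] that[of "{p 13}"] that[of "{p 13, p 14}"] R ij by (auto simp: card_insert_disjoint)
    qed
    define T where "T = sym_diff Z (R \<union> E)"
    have T: "T \<subseteq> {p 13, p 14}" "sym_diff Z T = R \<union> E" using E(1) by (auto simp: T_def R_def)
    have "R \<union> E \<in> code15" using E R pn[of 13] pn[of 14] by (auto simp: code15_def)
    moreover have "T \<subseteq> {..<15}" using T(1) pn[of 13] pn[of 14] by auto
    ultimately have "(\<Sum>i<15. a i) - 2 * (\<Sum>i\<in>T. a i) \<le> h" using C T(2) by simp
    moreover have "(\<Sum>i\<in>T. a i) \<le> (\<Sum>i\<in>{p 13, p 14}. a i)" using T(1) a by (intro sum_mono2) auto
    ultimately show ?thesis using ij by simp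
  qed
  moreover have "(\<Sum>i<15. a i) \<le> h + 2 * a (p 3)"
  proof -
    have flip: ?thesis if "i < 15" "3 \<le> i" "sym_diff Z {p i} \<in> code15" for i
    proof -
      have "(\<Sum>j<15. a j) - 2 * (\<Sum>j\<in>{p i}. a j) \<le> h" using C[of "{p i}"] that pn[of i] by simp
      then show ?thesis using dec[of 3 i] that by simp
    qed
    have low: "card (p ` {..<3}) \<le> 3" using card_image_le[of "{..<3::nat}" p] by simp
    have beyond: "\<exists>i. i < 15 \<and> 3 \<le> i \<and> p i \<in> Y" if "Y \<subseteq> {..<15}" "4 \<le> card Y" for Y
    proof -
      have "\<not> Y \<subseteq> p ` {..<3}" using card_mono[of "p ` {..<3}" Y] low that by auto
      then obtain y where y: "y \<in> Y" "y \<notin> p ` {..<3}" by blast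
      have "y \<in> p ` {..<15}" using that(1) y(1) surj by blast
      then obtain i where i: "i < 15" "y = p i" by auto
      have "3 \<le> i"
      proof (rule ccontr)
        assume "\<not> 3 \<le> i"
        then have "p i \<in> p ` {..<3}" by simp
        then show False using y(2) i(2) by simp
      qed
      then show ?thesis using i y(1) by blast
    qed
    have "c \<in> weights15 \<or> 4 \<le> c \<and> c - 1 \<in> weights15 \<or> c \<le> 11 \<and> c + 1 \<in> weights15" if "c \<le> 15" for c
      using that unfolding weights15_def by simp presburger
    then consider "card Z \<in> weights15" | "4 \<le> card Z" "card Z - 1 \<in> weights15" | "card Z \<le> 11" "card Z + 1 \<in> weights15"
      using cardZ by blast
    then show ?thesis
    proof cases
      case 1
      then have "(\<Sum>i<15. a i) \<le> h" using C[of "{}"] Z by (simp add: code15_def)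
      then show ?thesis using a[of "p 3"] by simp
    next
      case 2
      then obtain i where i: "i < 15" "3 \<le> i" "p i \<in> Z" using beyond[OF Z] by blast
      have "card (Z - {p i}) = card Z - 1" using i(3) by (simp add: card_Diff_singleton)
      moreover have "Z - {p i} \<subseteq> {..<15}" using Z by blast
      ultimately have "Z - {p i} \<in> code15" using 2(2) unfolding code15_def by simp
      moreover have "sym_diff Z {p i} = Z - {p i}" using i(3) by blast
      ultimately have "sym_diff Z {p i} \<in> code15" by (simp only:)
      then show ?thesis using flip i(1,2) by blast
    next
      case 3
      have "card ({..<15} - Z) = 15 - card Z" using Z finZ by (simp add: card_Diff_subset)
      then have "4 \<le> card ({..<15} - Z)" using 3(1) by simp
      then obtain i where i: "i < 15" "3 \<le> i" "p i \<in> {..<15} - Z" using beyond[OF Diff_subset] by blast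
      have "card (insert (p i) Z) = card Z + 1" using finZ i(3) by simp
      moreover have "insert (p i) Z \<subseteq> {..<15}" using Z i(3) by blast
      ultimately have "insert (p i) Z \<in> code15" using 3(2) unfolding code15_def by simp
      moreover have "sym_diff Z {p i} = insert (p i) Z" using i(3) by blast
      ultimately have "sym_diff Z {p i} \<in> code15" by (simp only:)
      then show ?thesis using flip i(1,2) by blast
    qed
  qed
  ultimately have "(\<Sum>i<15. a (p i)) \<le> h + 2 * min (a (p 3)) (a (p 13) + a (p 14))"
    unfolding reindex by (simp add: min_def)
  moreover have "0 \<le> min (a (p 3)) (a (p 13) + a (p 14))" using a by simp
  moreover have "min (a (p 3)) (a (p 13) + a (p 14)) \<le> a (p 3)" "min (a (p 3)) (a (p 13) + a (p 14)) \<le> a (p 13) + a (p 14)"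
    by (rule min.cobounded1, rule min.cobounded2)
  ultimately show ?thesis by blast
qed

text \<open>
  Here \<open>a, b, u\<close> are the three largest entries and the tail bound applies from the fourth on. The terms that
  contain the lost entry \<open>m\<close> or the loss \<open>l\<close> are collected in \<open>X\<close>, and \<open>X\<close> is bounded by its values for extreme \<open>m\<close> and
  \<open>l\<close>.
\<close>

lemma split_quadruples_small:
  fixes a b u m l :: real
  assumes m: "0 \<le> m" "m \<le> u" and l: "0 \<le> l" "l \<le> u" "l \<le> 2 * m"
    and ab: "u \<le> b" "b \<le> a" "a \<le> 1" "a + b + u \<le> 17321/10000" and u: "u \<le> 1/2"
    and T: "T = 38730/10000 - a - b - u"
  shows "a\<^sup>2 + b\<^sup>2 + u\<^sup>2 + (u * T + (m * T + 2 * m * l + u * l - 10 * (u * m))) \<le> 15 / 7"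
proof -
  define r h :: real where "r = 17321/10000" and "h = 38730/10000"
  define X where "X = m * (h - r) + 2 * m * l + u * l - 10 * (u * m)"
  have X: "X \<le> 0 \<or> X \<le> u * (10705/10000 - 3 * u) \<or> X \<le> u * (21409/10000 - 7 * u)"
  proof (cases "2 * m \<le> u")
    case True
    have "l * (2 * m + u) \<le> 2 * m * (2 * m + u)" using l m by (intro mult_right_mono) auto
    then have "X \<le> m * (21409/10000 - 8 * u + 2 * (2 * m))"
      unfolding X_def r_def h_def by (simp add: algebra_simps)
    also have "\<dots> = (2 * m) * ((21409/20000 - 4 * u) + 2 * m)" by (simp add: algebra_simps)
    also have "\<dots> \<le> (2 * m) * (21409/20000 - 3 * u)" using True m by (intro mult_left_mono) auto
    finally have "X \<le> (2 * m) * (21409/20000 - 3 * u)" .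
    moreover have "(2 * m) * (21409/20000 - 3 * u) \<le> max 0 (u * (21409/20000 - 3 * u))"
    proof (cases "21409/20000 - 3 * u \<le> 0")
      case True
      then show ?thesis using m by (simp add: mult_nonneg_nonpos le_max_iff_disj)
    next
      case False
      then show ?thesis using \<open>2 * m \<le> u\<close> by (intro max.coboundedI2 mult_right_mono) auto
    qed
    moreover have "u * (21409/20000 - 3 * u) \<le> u * (10705/10000 - 3 * u)"
      using m by (intro mult_left_mono) auto
    ultimately show ?thesis by (auto simp: max_def split: if_splits)
  next
    case False
    have "l * (2 * m + u) \<le> u * (2 * m + u)" using l m by (intro mult_right_mono) auto
    then have *: "X \<le> m * (21409/10000 - 8 * u) + u * u"
      unfolding X_def r_def h_def by (simp add: algebra_simps)
    show ?thesis
    proof (cases "21409/10000 - 8 * u \<le> 0")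
      case True
      have "m * (21409/10000 - 8 * u) \<le> (u / 2) * (21409/10000 - 8 * u)"
        using True False by (intro mult_right_mono_neg) auto
      then have "X \<le> u * (10705/10000 - 3 * u)" using * m by (simp add: algebra_simps)
      then show ?thesis by simp
    next
      case False
      then have "m * (21409/10000 - 8 * u) \<le> u * (21409/10000 - 8 * u)"
        using m by (intro mult_right_mono) auto
      then have "X \<le> u * (21409/10000 - 7 * u)" using * by (simp add: algebra_simps)
      then show ?thesis by simp
    qed
  qed
  \<comment> \<open>Up to \<open>u = 0.36\<close> the caps \<open>a, b \<le> 1\<close> suffice; from there on \<open>a, b \<le> r - 2 * u\<close> is used instead, and \<open>X\<close> is no longer positive.\<close>
  show ?thesis
  proof (cases "u \<le> 36/100")
    case True
    have "0 \<le> (1 - a) * (a - u)" "0 \<le> (1 - b) * (b - u)" "0 \<le> (1 - m) * (r - a - b - u)"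
      using assms by (auto intro!: mult_nonneg_nonneg simp: r_def)
    then have "a\<^sup>2 + b\<^sup>2 + u\<^sup>2 + (u * T + (m * T + 2 * m * l + u * l - 10 * (u * m))) \<le> r + u * (h - 3) + X"
      unfolding T X_def h_def[symmetric] by (simp add: algebra_simps power2_eq_square)
    moreover have "r + u * (h - 3) + X \<le> 15 / 7"
    proof -
      have "0 \<le> (u - 32/100)\<^sup>2" "0 \<le> (u - 215/1000)\<^sup>2" by simp_all
      then show ?thesis using X True m unfolding r_def h_def
        by (auto simp: algebra_simps power2_eq_square add_divide_distrib diff_divide_distrib)
    qed
    ultimately show ?thesis by linarith
  next
    case False
    have "0 \<le> (r - 2 * u - a) * (a - u)" "0 \<le> (r - 2 * u - b) * (b - u)" "0 \<le> (r - 2 * u - m) * (r - a - b - u)"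
      using assms by (auto intro!: mult_nonneg_nonneg simp: r_def)
    then have "a\<^sup>2 + b\<^sup>2 + u\<^sup>2 + (u * T + (m * T + 2 * m * l + u * l - 10 * (u * m))) \<le> r\<^sup>2 + (h - 5 * r) * u + 6 * u\<^sup>2 + X"
      unfolding T X_def h_def[symmetric] by (simp add: algebra_simps power2_eq_square)
    moreover have "u * (10705/10000 - 3 * u) \<le> 0" "u * (21409/10000 - 7 * u) \<le> 0"
      using False by (auto intro!: mult_nonneg_nonpos)
    then have "X \<le> 0" using X by linarith
    moreover have "r\<^sup>2 + (h - 5 * r) * u + 6 * u\<^sup>2 \<le> 15 / 7"
    proof -
      have "0 \<le> (u - 36/100) * (1/2 - u)" using False u by (intro mult_nonneg_nonneg) auto
      then show ?thesis using False u unfolding r_def h_def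
        by (simp add: algebra_simps power2_eq_square add_divide_distrib diff_divide_distrib)
    qed
    ultimately show ?thesis by linarith
  qed
qed

text \<open>
  For \<open>u \<ge> 1/2\<close> the four entries \<open>c, d, e, v\<close> after \<open>a, b, u\<close> are added to the head, because the split quadruples
  limit their sum to 2. The term \<open>t\<close> stands for the tail, whose bound is \<open>v * T\<close> without and \<open>2 * v * T\<close> with
  an effect of the loss; the latter occurs only if \<open>2 * v \<le> T\<close>.
\<close>

lemma split_quadruples_large:
  fixes a b u c d e v t T :: real
  assumes z: "0 \<le> v" "v \<le> e" "e \<le> d" "d \<le> c" "c \<le> u" "u \<le> b" "b \<le> a" "a + b + u \<le> 17321/10000"
    and quad: "c + d + e + v \<le> 2" and u: "1/2 \<le> u"
    and T: "T = 38730/10000 - a - b - u - c - d - e - v"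
    and t: "t \<le> v * T \<or> 2 * v \<le> T \<and> t \<le> 2 * v * T"
  shows "a\<^sup>2 + b\<^sup>2 + u\<^sup>2 + c\<^sup>2 + d\<^sup>2 + e\<^sup>2 + v\<^sup>2 + t \<le> 15 / 7"
proof -
  define r h H C :: real where "r = 17321/10000" and "h = 38730/10000"
    and "H = r\<^sup>2 - 4 * r * u + 6 * u\<^sup>2" and "C = c + d + e"
  have cde: "c\<^sup>2 + d\<^sup>2 + e\<^sup>2 \<le> (u + v) * C - 3 * u * v"
  proof -
    have "0 \<le> (c - v) * (u - c)" "0 \<le> (d - v) * (u - d)" "0 \<le> (e - v) * (u - e)"
      using assms by (auto intro!: mult_nonneg_nonneg)
    then show ?thesis by (simp add: algebra_simps power2_eq_square C_def)
  qed
  have ab: "a\<^sup>2 + b\<^sup>2 \<le> (r - u) * (a + b) - 2 * (r - 2 * u) * u"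
  proof -
    have "0 \<le> (r - 2 * u - a) * (a - u)" "0 \<le> (r - 2 * u - b) * (b - u)"
      using assms by (auto intro!: mult_nonneg_nonneg simp: r_def)
    then show ?thesis by (simp add: algebra_simps power2_eq_square)
  qed
  have C: "3 * v \<le> C" "C \<le> 3 * u" "C \<le> 2 - v" using z quad by (auto simp: C_def)
  have T': "T = h - a - b - u - C - v" by (simp add: T h_def C_def)
  have u2: "u \<le> 57737/100000" using z by linarith
  have v2: "v \<le> 1/2" using z quad by linarith
  from t show ?thesis
  proof
    assume t: "t \<le> v * T"
    have "0 \<le> (r - u - v) * (r - a - b - u)"
      using assms by (intro mult_nonneg_nonneg) (auto simp: r_def)
    then have "a\<^sup>2 + b\<^sup>2 + u\<^sup>2 + c\<^sup>2 + d\<^sup>2 + e\<^sup>2 + v\<^sup>2 + v * T \<le> H + u * C - 3 * u * v + v * (h - r)"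
      using ab cde unfolding T' H_def by (simp add: algebra_simps power2_eq_square)
    also have "\<dots> \<le> 15 / 7"
    proof (cases "v \<le> 2 - 3 * u")
      case True
      have "u * C \<le> u * (3 * u)" using C u by (intro mult_left_mono) auto
      moreover have "H + u * (3 * u) - 3 * u * v + v * (h - r) \<le> 15 / 7"
      proof -
        have "0 \<le> (2 - 3 * u - v) * (21409/10000 - 3 * u)" "0 \<le> (u - 1/2) * (57737/100000 - u)"
          using True u u2 by (auto intro!: mult_nonneg_nonneg)
        then show ?thesis using u u2 unfolding H_def r_def h_def
          by (simp add: algebra_simps power2_eq_square add_divide_distrib diff_divide_distrib)
      qed
      ultimately show ?thesis by linarith
    next
      case False
      have "u * C \<le> u * (2 - v)" using C u by (intro mult_left_mono) auto
      moreover have "0 \<le> (v + 3 * u - 2) * (57737/100000 - u)" "0 \<le> (1/2 - v) * (u - 1/2)" "0 \<le> (1/2 - v) * (57737/100000 - u)"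
        "0 \<le> (u - 1/2) * (57737/100000 - u)" "0 \<le> (v + 3 * u - 2) * (1/2 - v)"
        using False u u2 v2 by (auto intro!: mult_nonneg_nonneg)
      ultimately show ?thesis using u u2 v2 False unfolding H_def r_def h_def
        by (simp add: algebra_simps power2_eq_square add_divide_distrib diff_divide_distrib)
    qed
    finally show ?thesis using t by linarith
  next
    assume t: "2 * v \<le> T \<and> t \<le> 2 * v * T"
    have v3: "v \<le> 4/10" using t C z u unfolding T' h_def by linarith
    have "6 * v \<le> h - 3 * u" using t C z unfolding T' by linarith
    \<comment> \<open>The constraint \<open>2 * v \<le> T\<close> enters with the multiplier \<open>(u - v) / 2\<close>, which halves the coefficient of \<open>C\<close>.\<close>
    then have "0 \<le> (r - u - 2 * v - (u - v) / 2) * (r - a - b - u)"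
      using assms u2 by (intro mult_nonneg_nonneg) (auto simp: r_def h_def)
    moreover have "0 \<le> ((u - v) / 2) * (T - 2 * v)" "0 \<le> ((u - v) / 2) * (3 * u - C)"
      using t z C by (auto intro!: mult_nonneg_nonneg)
    ultimately have "a\<^sup>2 + b\<^sup>2 + u\<^sup>2 + c\<^sup>2 + d\<^sup>2 + e\<^sup>2 + v\<^sup>2 + 2 * v * T
        \<le> H + (3 * u\<^sup>2 - 3 * u * v) / 2 - 3 * u * v + v\<^sup>2 + (2 * v + (u - v) / 2) * (h - r - v) - (u - v) * v"
      using ab cde unfolding T' H_def by (simp add: algebra_simps power2_eq_square add_divide_distrib diff_divide_distrib)
    also have "\<dots> \<le> 15 / 7"
    proof -
      have "0 \<le> (u - 1/2) * (57737/100000 - u)" "0 \<le> v * (4/10 - v)" "0 \<le> (4/10 - v) * (u - 1/2)" "0 \<le> (4/10 - v) * (57737/100000 - u)"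
        "0 \<le> v * (u - 1/2)" "0 \<le> v * (57737/100000 - u)"
        using u u2 v3 z by (auto intro!: mult_nonneg_nonneg)
      then show ?thesis using u u2 v3 z unfolding H_def r_def h_def
        by (simp add: algebra_simps power2_eq_square add_divide_distrib diff_divide_distrib)
    qed
    finally show ?thesis using t by linarith
  qed
qed

lemma w_15_le: "w TYPE(15) \<le> 16442"
proof (rule w_le_of_code[where K = "{1,3}" and L = "{4}" and h = 8 and n = 15 and C = code15
      and loss = "\<lambda>z. \<exists>l\<ge>0. l \<le> z 3 \<and> l \<le> z 13 + z 14 \<and> (\<Sum>i<15. z i) \<le> sqrt (15::nat) + 2 * l"])
  have "(\<Sum>k\<in>{1,3}. 2 ^ k * (15 choose k)) + (\<Sum>k\<in>{4}. 2 ^ k * ((8 choose k) + ((15 - 8) choose k))) = (5350::nat)"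
    by (simp add: binomial_fact' fact_numeral)
  then show "(\<Sum>k\<in>{1,3}. 2 ^ k * (15 choose k)) + (\<Sum>k\<in>{4}. 2 ^ k * ((8 choose k) + ((15 - 8) choose k))) + card code15 \<le> 16442"
    using card_code15 by linarith
  show "Z \<subseteq> {..<15}" if "Z \<in> code15" for Z using that by (simp add: code15_def)
  show "{..<15} - Z \<in> code15" if "Z \<in> code15" for Z using code15_compl that .
next
  fix a :: "nat \<Rightarrow> real" and p :: "nat \<Rightarrow> nat" and Z
  assume "bij_betw p {..<15} {..<15}" "\<And>i j. i \<le> j \<Longrightarrow> j < 15 \<Longrightarrow> a (p j) \<le> a (p i)" "\<And>i. 0 \<le> a i" "Z \<subseteq> {..<15}"
    "\<And>T. T \<subseteq> {..<15} \<Longrightarrow> sym_diff Z T \<in> code15 \<Longrightarrow> (\<Sum>i<15. a i) - 2 * (\<Sum>i\<in>T. a i) \<le> sqrt (15::nat)"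
  then show "\<exists>l\<ge>0. l \<le> a (p 3) \<and> l \<le> a (p 13) + a (p 14) \<and> (\<Sum>i<15. a (p i)) \<le> sqrt (15::nat) + 2 * l"
    by (rule code15_loss)
next
  fix z :: "nat \<Rightarrow> real"
  assume dec: "\<And>i j. i \<le> j \<Longrightarrow> j < 15 \<Longrightarrow> z j \<le> z i" and nonneg: "\<And>i. 0 \<le> z i"
    and K: "\<And>k. k \<in> {1,3} \<Longrightarrow> (\<Sum>i<k. z i) \<le> sqrt k"
    and L: "\<And>k. k \<in> {4} \<Longrightarrow> (\<Sum>i\<in>{k - 1..<2 * k - 1}. z i) \<le> sqrt k"
    and loss: "\<exists>l\<ge>0. l \<le> z 3 \<and> l \<le> z 13 + z 14 \<and> (\<Sum>i<15. z i) \<le> sqrt (15::nat) + 2 * l"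
  obtain l where l: "0 \<le> l" "l \<le> z 3" "l \<le> z 13 + z 14" and h: "(\<Sum>i<15. z i) \<le> 38730/10000 + 2 * l"
    using loss sqrt_bounds(10) by fastforce
  have a: "z 0 \<le> 1" using K[of 1] by simp
  have r: "z 0 + z 1 + z 2 \<le> 17321/10000" using K[of 3] sqrt_bounds(2) by (simp add: sum_numerals_unfold)
  have "sqrt 4 = (2::real)" using real_sqrt_abs[of 2] by simp
  then have q: "z 3 + z 4 + z 5 + z 6 \<le> 2" using L[of 4] by (simp add: sum_numerals_unfold)
  have l2: "l \<le> 2 * z 13" using l(3) dec[of 13 14] by simp
  have split: "(\<Sum>i<15. (z i)\<^sup>2) = (\<Sum>i<k. (z i)\<^sup>2) + (\<Sum>i\<in>{k..<15}. (z i)\<^sup>2)"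
    "(\<Sum>i<15. z i) = (\<Sum>i<k. z i) + (\<Sum>i\<in>{k..<15}. z i)" if "k \<le> 15" for k
    using sum_split_at[OF that] by auto
  have "(\<Sum>i<15. (z i)\<^sup>2) \<le> 15 / 7"
  \<comment> \<open>If \<open>z 2\<close> is small the head of three entries suffices; otherwise the split quadruples take part.\<close>
  proof (cases "z 2 \<le> 1/2")
    case True
    define T where "T = 38730/10000 - z 0 - z 1 - z 2"
    have "(\<Sum>i\<in>{3..<15}. z i) \<le> T + 2 * l"
      using h split(2)[of 3] by (simp add: T_def sum_numerals_unfold)
    then have "(\<Sum>i\<in>{3..<15}. (z i)\<^sup>2) \<le> z 2 * T + (z 13 * T + 2 * z 13 * l + z 2 * l - 10 * (z 2 * z 13))"
      using tail_bound_two(1)[of 15 z 3 "z 2" "z 13" l T] dec nonneg l by simp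
    moreover have "(z 0)\<^sup>2 + (z 1)\<^sup>2 + (z 2)\<^sup>2 + (z 2 * T + (z 13 * T + 2 * z 13 * l + z 2 * l - 10 * (z 2 * z 13))) \<le> 15 / 7"
    proof (rule split_quadruples_small)
      show "l \<le> z 2" using l(2) dec[of 2 3] by simp
    qed (use dec nonneg l l2 a r True in \<open>auto simp: T_def\<close>)
    ultimately show ?thesis using split(1)[of 3] by (simp add: sum_numerals_unfold)
  next
    case False
    define T where "T = 38730/10000 - z 0 - z 1 - z 2 - z 3 - z 4 - z 5 - z 6"
    define X where "X = z 13 * T + 2 * z 13 * l + z 6 * l - 6 * (z 6 * z 13)"
    have T: "(\<Sum>i\<in>{7..<15}. z i) \<le> T + 2 * l"
      using h split(2)[of 7] by (simp add: T_def sum_numerals_unfold)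
    have tail: "(\<Sum>i\<in>{7..<15}. (z i)\<^sup>2) \<le> z 6 * T + X" "6 * z 13 \<le> T + l"
      using tail_bound_two[of 15 z 7 "z 6" "z 13" l T] dec nonneg l T by (simp_all add: X_def)
    have m: "0 \<le> z 13" "z 13 \<le> z 6" using dec nonneg by auto
    have "l * (2 * z 13 + z 6) \<le> 2 * z 13 * (2 * z 13 + z 6)" using l2 m by (intro mult_right_mono) auto
    then have X: "X \<le> z 13 * (T + 4 * z 13 - 4 * z 6)" by (simp add: X_def algebra_simps)
    have "z 6 * T + X \<le> z 6 * T \<or> 2 * z 6 \<le> T \<and> z 6 * T + X \<le> 2 * z 6 * T"
    proof (cases "T + 4 * z 13 - 4 * z 6 \<le> 0")
      case True
      then have "X \<le> 0" using X m by (smt (verit) mult_nonneg_nonpos)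
      then show ?thesis by simp
    next
      case False
      have "z 13 * (T + 4 * z 13 - 4 * z 6) \<le> z 6 * T" using False m by (intro mult_mono) auto
      moreover have "2 * z 6 \<le> T" using False tail(2) l2 by linarith
      moreover have "X \<le> z 6 * T" using X calculation(1) by linarith
      ultimately show ?thesis by (simp add: mult.commute)
    qed
    then have "(z 0)\<^sup>2 + (z 1)\<^sup>2 + (z 2)\<^sup>2 + (z 3)\<^sup>2 + (z 4)\<^sup>2 + (z 5)\<^sup>2 + (z 6)\<^sup>2 + (z 6 * T + X) \<le> 15 / 7"
      using dec nonneg r q False by (intro split_quadruples_large) (auto simp: T_def)
    then show ?thesis using tail(1) split(1)[of 7] by (simp add: sum_numerals_unfold)
  qed
  then show "(\<Sum>i<15. (z i)\<^sup>2) \<le> 2 * real 15 / (real 15 - 1)" by simp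
qed auto

section \<open>The upper bounds\<close>

theorem theorem1:
  "w TYPE(5) \<le> 30 \<and> w TYPE(6) \<le> 44 \<and> w TYPE(7) \<le> 112 \<and> w TYPE(8) \<le> 240 \<and>
   w TYPE(9) \<le> 470 \<and> w TYPE(10) \<le> 692 \<and> w TYPE(11) \<le> 2024 \<and> w TYPE(12) \<le> 3832 \<and>
   w TYPE(13) \<le> 7074 \<and> w TYPE(14) \<le> 11132 \<and> w TYPE(15) \<le> 16442"
  using w_5_le w_6_le w_7_le w_8_le w_9_le w_10_le w_11_le w_12_le w_13_le w_14_le w_15_le by simp

end
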